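(* Let $\mathbb F$ be algebraically closed of characteristic $0$, let $V$ be a vector space over $\mathbb F$ of finite positive dimension, and let $A,A^*$ be a TD pair on $V$ of Krawtchouk type. Let $\tilde V$ be the dual space of $V$ and let $B$ (resp. $B^*$) be the image of $A$ (resp. $A^*$) under the canonical anti-isomorphism $\mathrm{End}(V)\to\mathrm{End}(\tilde V)$. Then the TD pairs $A,A^*$ and $B,B^*$ are isomorphic.
   Context: The canonical anti-isomorphism $\mathrm{End}(V)\to\mathrm{End}(\tilde V)$ sends $X$ to the unique $X'\in\mathrm{End}(\tilde V)$ with $(X'f)(v)=f(Xv)$ for all $f\in\tilde V$, $v\in V$ (it is known that $B,B^*$ is a TD pair on $\tilde V$). An isomorphism of TD pairs from $A,A^*$ on $V$ to $B,B^*$ on $V'$ is a linear bijection $\gamma:V\to V'$ with $\gamma A=B\gamma$, $\gamma A^*=B^*\gamma$. A TD pair on a finite-dimensional $\mathbb F$-vector space $V$ is an ordered pair $A,A^*$ of diagonalizable linear maps on $V$ such that for some ordering $V_0,\dots,V_d$ of the eigenspaces of $A$ one has $A^*V_i\subseteq V_{i-1}+V_i+V_{i+1}$ ($0\le i\le d$), for some ordering $V^*_0,\dots,V^*_\delta$ of the eigenspaces of $A^*$ one has $AV^*_i\subseteq V^*_{i-1}+V^*_i+V^*_{i+1}$ ($0\le i\le\delta$) (terms with out-of-range index are $0$), and no subspace $W\neq 0,V$ satisfies $AW\subseteq W$, $A^*W\subseteq W$. Such orderings are called standard; an ordering of eigenvalues is standard if the corresponding ordering of eigenspaces is. It is known that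 $d=\delta$ (the diameter). The TD pair has Krawtchouk type if the sequence $(d-2i)_{i=0}^d$ is a standard ordering of the eigenvalues of $A$ and also a standard ordering of the eigenvalues of $A^*$. *)

theory Defs
  imports Main "HOL-Computational_Algebra.Polynomial" "HOL-Library.Function_Algebras"
begin

text \<open>A vector space is a type 'w with scalar multiplication scale (Vector_Spaces.vector_space);
 the space carrying a TD pair is a subspace U of it (U = UNIV for V itself, the set of
 linear functionals inside 'v => 'a for the dual space).\<close>

definition eigsp :: "('a::field \<Rightarrow> 'w::ab_group_add \<Rightarrow> 'w) \<Rightarrow> 'w set \<Rightarrow> ('w \<Rightarrow> 'w) \<Rightarrow> 'a \<Rightarrow> 'w set" where
  "eigsp scale U A \<theta> = {v \<in> U. A v = scale \<theta> v}"

definition is_eigenvalue :: "('a::field \<Rightarrow> 'w::ab_group_add \<Rightarrow> 'w) \<Rightarrow> 'w set \<Rightarrow> ('w \<Rightarrow> 'w) \<Rightarrow> 'a \<Rightarrow> bool" where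
  "is_eigenvalue scale U A \<theta> \<longleftrightarrow> eigsp scale U A \<theta> \<noteq> {0}"

definition diagonalizable_on :: "('a::field \<Rightarrow> 'w::ab_group_add \<Rightarrow> 'w) \<Rightarrow> 'w set \<Rightarrow> ('w \<Rightarrow> 'w) \<Rightarrow> bool" where
  "diagonalizable_on scale U A \<longleftrightarrow> module.span scale (\<Union>\<theta>. eigsp scale U A \<theta>) = U"

text \<open>The i-th eigenspace for an ordering th of eigenvalues; 0 for out-of-range indices.
 For i = 0 the "i-1" term below is E_0 itself (nat subtraction), which is harmless.\<close>
definition ord_eigsp :: "('a::field \<Rightarrow> 'w::ab_group_add \<Rightarrow> 'w) \<Rightarrow> 'w set \<Rightarrow> ('w \<Rightarrow> 'w) \<Rightarrow> 'a list \<Rightarrow> nat \<Rightarrow> 'w set" where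
  "ord_eigsp scale U A th i = (if i < length th then eigsp scale U A (th ! i) else {0})"

definition standard_ordering :: "('a::field \<Rightarrow> 'w::ab_group_add \<Rightarrow> 'w) \<Rightarrow> 'w set \<Rightarrow> ('w \<Rightarrow> 'w) \<Rightarrow> ('w \<Rightarrow> 'w) \<Rightarrow> 'a list \<Rightarrow> bool" where
  "standard_ordering scale U A As th \<longleftrightarrow>
     distinct th \<and> set th = {\<theta>. is_eigenvalue scale U A \<theta>} \<and>
     (\<forall>i < length th. As ` ord_eigsp scale U A th i \<subseteq>
        module.span scale (ord_eigsp scale U A th (i - 1) \<union> ord_eigsp scale U A th i
                             \<union> ord_eigsp scale U A th (Suc i)))"

definition td_pair :: "('a::field \<Rightarrow> 'w::ab_group_add \<Rightarrow> 'w) \<Rightarrow> 'w set \<Rightarrow> ('w \<Rightarrow> 'w) \<Rightarrow> ('w \<Rightarrow> 'w) \<Rightarrow> bool" where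
  "td_pair scale U A As \<longleftrightarrow>
     Vector_Spaces.linear scale scale A \<and> Vector_Spaces.linear scale scale As \<and>
     A ` U \<subseteq> U \<and> As ` U \<subseteq> U \<and>
     diagonalizable_on scale U A \<and> diagonalizable_on scale U As \<and>
     (\<exists>th. standard_ordering scale U A As th) \<and>
     (\<exists>th. standard_ordering scale U As A th) \<and>
     (\<forall>W. module.subspace scale W \<and> W \<subseteq> U \<and> A ` W \<subseteq> W \<and> As ` W \<subseteq> W
          \<longrightarrow> W = {0} \<or> W = U)"

definition krawtchouk_seq :: "nat \<Rightarrow> 'a::field list" where
  "krawtchouk_seq d = map (\<lambda>i. of_int (int d - 2 * int i)) [0..<Suc d]"

definition krawtchouk_type :: "('a::field \<Rightarrow> 'w::ab_group_add \<Rightarrow> 'w) \<Rightarrow> 'w set \<Rightarrow> ('w \<Rightarrow> 'w) \<Rightarrow> ('w \<Rightarrow> 'w) \<Rightarrow> bool" where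
  "krawtchouk_type scale U A As \<longleftrightarrow>
     (\<exists>d. standard_ordering scale U A As (krawtchouk_seq d) \<and>
          standard_ordering scale U As A (krawtchouk_seq d))"

definition td_iso :: "('a::field \<Rightarrow> 'w::ab_group_add \<Rightarrow> 'w) \<Rightarrow> 'w set \<Rightarrow> ('w \<Rightarrow> 'w) \<Rightarrow> ('w \<Rightarrow> 'w)
    \<Rightarrow> ('a \<Rightarrow> 'u::ab_group_add \<Rightarrow> 'u) \<Rightarrow> 'u set \<Rightarrow> ('u \<Rightarrow> 'u) \<Rightarrow> ('u \<Rightarrow> 'u) \<Rightarrow> ('w \<Rightarrow> 'u) \<Rightarrow> bool" where
  "td_iso scale U A As scale' U' B Bs \<gamma> \<longleftrightarrow>
     Vector_Spaces.linear scale scale' \<gamma> \<and> bij_betw \<gamma> U U' \<and>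
     (\<forall>v\<in>U. \<gamma> (A v) = B (\<gamma> v) \<and> \<gamma> (As v) = Bs (\<gamma> v))"

definition td_isomorphic where
  "td_isomorphic scale U A As scale' U' B Bs \<longleftrightarrow> (\<exists>\<gamma>. td_iso scale U A As scale' U' B Bs \<gamma>)"

definition dual_scale :: "'a::field \<Rightarrow> ('v \<Rightarrow> 'a) \<Rightarrow> ('v \<Rightarrow> 'a)" where
  "dual_scale c f = (\<lambda>x. c * f x)"

definition dual_space :: "('a::field \<Rightarrow> 'v::ab_group_add \<Rightarrow> 'v) \<Rightarrow> ('v \<Rightarrow> 'a) set" where
  "dual_space scale = {f. Vector_Spaces.linear scale (*) f}"

definition dual_map :: "('v \<Rightarrow> 'v) \<Rightarrow> ('v \<Rightarrow> 'a) \<Rightarrow> ('v \<Rightarrow> 'a)" where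
  "dual_map X f = (\<lambda>v. f (X v))"

end

theory Submission
  imports Defs
begin

text \<open>
  Let \<open>s\<close> and \<open>t\<close> be the involutions acting as \<open>(-1)^i\<close> on the \<open>i\<close>-th eigenspace of \<open>A\<close> and of
  \<open>A*\<close>. Conjugating \<open>A\<close>, \<open>A*\<close> by the dihedral group they generate gives operators \<open>A k\<close>, \<open>k\<close> an
  integer, with \<open>A 0 = A\<close> and \<open>A 1 = A*\<close>, and these satisfy the relations of the Onsager algebra.
  Relative to \<open>A*\<close> that algebra splits into a raising, a lowering and a weight zero part; the last
  one is spanned by the commuting elements \<open>A (1 + m) + A (1 - m)\<close>. Transposition maps each
  \<open>A k\<close> to its counterpart on the dual space, hence exchanges raising and lowering operators and
  fixes the weight zero part. So \<open>V\<close> and its dual are irreducible highest weight modules with the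
  same highest weight. The isomorphism is read off from the submodule of \<open>V \<times> V~\<close> generated by a
  pair of highest weight vectors: irreducibility makes it the graph of a bijection.
\<close>

section \<open>The Onsager relations\<close>

text \<open>The sort \<open>{ring, semiring_numeral}\<close> replaces \<open>ring_1\<close> because the endomorphisms of the
  trivial group satisfy \<open>0 = 1\<close>; for the same reason torsion-freeness is expressed by sums
  instead of \<open>of_nat\<close>.\<close>

definition bracket :: "'r::{ring,semiring_numeral} \<Rightarrow> 'r \<Rightarrow> 'r" ("\<lblot>_,/ _\<rblot>") where
  "\<lblot>a, b\<rblot> = a * b - b * a"

lemma bracket_simps:
  "\<lblot>a + b, c\<rblot> = \<lblot>a, c\<rblot> + \<lblot>b, c\<rblot>" "\<lblot>c, a + b\<rblot> = \<lblot>c, a\<rblot> + \<lblot>c, b\<rblot>"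
  "\<lblot>a - b, c\<rblot> = \<lblot>a, c\<rblot> - \<lblot>b, c\<rblot>" "\<lblot>c, a - b\<rblot> = \<lblot>c, a\<rblot> - \<lblot>c, b\<rblot>"
  "\<lblot>- a, c\<rblot> = - \<lblot>a, c\<rblot>" "\<lblot>c, - a\<rblot> = - \<lblot>c, a\<rblot>"
  "\<lblot>2 * a, c\<rblot> = 2 * \<lblot>a, c\<rblot>" "\<lblot>c, 2 * a\<rblot> = 2 * \<lblot>c, a\<rblot>"
  "\<lblot>a, a\<rblot> = 0" "\<lblot>0, a\<rblot> = 0" "\<lblot>a, 0\<rblot> = 0"
  by (simp_all add: bracket_def algebra_simps mult_2 mult_2_right)

lemma bracket_skew: "\<lblot>b, a\<rblot> = - \<lblot>a, b\<rblot>"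
  by (simp add: bracket_def)

lemma bracket_Leibniz: "\<lblot>a, \<lblot>b, c\<rblot>\<rblot> = \<lblot>\<lblot>a, b\<rblot>, c\<rblot> + \<lblot>b, \<lblot>a, c\<rblot>\<rblot>"
  by (simp add: bracket_def algebra_simps)

lemma bracket_conj:
  assumes "s * s = (1::'r::{ring,semiring_numeral})"
  shows "s * \<lblot>a, b\<rblot> * s = \<lblot>s * a * s, s * b * s\<rblot>"
proof -
  have "s * (s * c) = c" for c using assms by (metis mult.assoc mult_1)
  then show ?thesis by (simp add: bracket_def algebra_simps)
qed

text \<open>Composing the reflections \<open>k \<mapsto> - k\<close> and
  \<open>k \<mapsto> 2 - k\<close> translates indices by 2, so statements about the orbit propagate
  from the base indices 0 and 1.\<close>

lemma int_step2_induct: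
  assumes "P (0::int)" "P 1" "\<And>k. P k \<Longrightarrow> P (k + 2)" "\<And>k. P k \<Longrightarrow> P (k - 2)"
  shows "P k"
proof -
  have *: "P (2 * k) \<and> P (2 * k + 1)" for k
  proof (induction k rule: int_induct[where k = 0])
    case base then show ?case using assms by simp
  next
    case (step1 i) then show ?case using assms(3)[of "2*i"] assms(3)[of "2*i+1"]
      by (simp add: algebra_simps)
  next
    case (step2 i) then show ?case using assms(4)[of "2*i"] assms(4)[of "2*i+1"]
      by (simp add: algebra_simps)
  qed
  show ?thesis using *[of "k div 2"] by (cases "even k") auto
qed

text \<open>On indices, \<open>s\<close> and \<open>t\<close> act as the reflections about 0 and 1,
  which match \<open>sx\<close> and \<open>ty\<close>. The last clause later shows that every
  \<open>A k\<close> commutes with scalars.\<close>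

lemma dihedral_orbit:
  fixes x y s t :: "'r::{ring,semiring_numeral}"
  assumes s: "s * s = 1" and t: "t * t = 1" and sx: "s * x = x * s" and ty: "t * y = y * t"
  obtains A :: "int \<Rightarrow> 'r" where "A 0 = x" "A 1 = y"
    "\<And>k. s * A k * s = A (- k)" "\<And>k. t * A k * t = A (2 - k)"
    "\<And>k z. z * x = x * z \<Longrightarrow> z * y = y * z \<Longrightarrow> z * s = s * z \<Longrightarrow> z * t = t * z \<Longrightarrow> z * A k = A k * z"
proof -
  \<comment> \<open>\<open>P k\<close> is the k-th power of \<open>t * s\<close>, whose inverse is
    \<open>s * t\<close>. Conjugation by \<open>P j\<close> moves \<open>x\<close> to index
    \<open>2 * j\<close> and \<open>y\<close> to index \<open>2 * j + 1\<close>.\<close>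
  define P :: "int \<Rightarrow> 'r" where "P k = (if 0 \<le> k then (t * s) ^ nat k else (s * t) ^ nat (- k))" for k
  define A where "A k = P (k div 2) * (if even k then x else y) * P (- (k div 2))" for k
  have ss: "s * (s * c) = c" and tt: "t * (t * c) = c" for c
    using s t by (metis mult.assoc mult_1)+
  have P1: "P (k + 1) = t * s * P k" for k
  proof (cases "k \<ge> 0")
    case True then show ?thesis by (simp add: P_def nat_add_distrib)
  next
    case False
    then have "nat (- k) = Suc (nat (- (k + 1)))" by simp
    then show ?thesis using False by (auto simp: P_def mult.assoc ss tt)
  qed
  have P2: "P (k - 1) = s * t * P k" for k
    using P1[of "k - 1"] by (simp add: mult.assoc ss tt)
  have P1': "P (k + 1) = P k * (t * s)" for k
  proof (cases "k \<ge> 0")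
    case True then show ?thesis by (simp add: P_def nat_add_distrib power_Suc2 del: power_Suc)
  next
    case False
    then have "nat (- k) = Suc (nat (- (k + 1)))" by simp
    then show ?thesis using False
      by (auto simp: P_def mult.assoc ss tt s t power_Suc2 simp del: power_Suc)
  qed
  have P2': "P (k - 1) = P k * (s * t)" for k
    using P1'[of "k - 1"] by (simp add: mult.assoc ss tt s t)
  have up: "A (k + 2) = t * s * A k * (s * t)" for k
  proof -
    have "(k + 2) div 2 = k div 2 + 1" by simp
    moreover have "- (k div 2 + 1) = - (k div 2) - 1" by simp
    ultimately show ?thesis by (simp only: A_def P1 P2') (simp add: mult.assoc)
  qed
  have down: "A (k - 2) = s * t * A k * (t * s)" for k
    using up[of "k - 2"] by (simp add: mult.assoc ss tt s t)
  have A0: "A 0 = x" and A1: "A 1 = y" by (simp_all add: A_def P_def)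
  have refl_s: "s * A k * s = A (- k)" for k
  proof (induction k rule: int_step2_induct)
    case 1 then show ?case by (simp add: A0 sx mult.assoc s)
  next
    case 2
    have "A (- 1) = s * t * A 1 * (t * s)" using down[of 1] by simp
    also have "\<dots> = s * y * s" by (simp add: A1 mult.assoc ss tt ty)
    finally show ?case by (simp add: A1)
  next
    case (3 k)
    have "- (k + 2) = (- k) - 2" by simp
    then show ?case using 3[symmetric] by (simp only: up down) (simp add: mult.assoc ss tt s t)
  next
    case (4 k)
    have "- (k - 2) = (- k) + 2" by simp
    then show ?case using 4[symmetric] by (simp only: up down) (simp add: mult.assoc ss tt s t)
  qed
  have refl_t: "t * A k * t = A (2 - k)" for k
  proof -
    have "A (2 - k) = t * s * (s * A k * s) * (s * t)" using up[of "- k"] refl_s[of k] by simp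
    then show ?thesis by (simp add: mult.assoc ss)
  qed
  have "z * A k = A k * z"
    if "z * x = x * z" "z * y = y * z" "z * s = s * z" "z * t = t * z" for z k
  proof -
    have "z * s * t = s * t * z" "z * t * s = t * s * z" using that by (metis mult.assoc)+
    then have "z * P k = P k * z" for k
      by (simp add: P_def mult.assoc power_commuting_commutes)
    then show ?thesis unfolding A_def using that by (smt (verit, ccfv_threshold) mult.assoc)
  qed
  with A0 A1 refl_s refl_t show ?thesis using that by blast
qed

text \<open>The hypotheses contain the Dolan-Grady relations: the bracket of \<open>x\<close> with
  \<open>s * y * s\<close> is \<open>- \<lblot>x, y\<rblot>\<close>, so the triple bracket with
  \<open>x\<close> gives \<open>4 * \<lblot>x, y\<rblot>\<close>, and likewise for \<open>y\<close>.
  Distance 1 follows by reflection, larger distances by induction.\<close>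

theorem Onsager_relations:
  fixes x y s t :: "'r::{ring,semiring_numeral}"
  assumes tf: "\<And>n X. (\<Sum>i\<le>n::nat. (X::'r)) = 0 \<Longrightarrow> X = 0"
    and s: "s * s = 1" and t: "t * t = 1" and sx: "s * x = x * s" and ty: "t * y = y * t"
    and xy: "\<lblot>x, \<lblot>x, y\<rblot>\<rblot> = 2 * (y - s * y * s)" "\<lblot>x, y + s * y * s\<rblot> = 0"
    and yx: "\<lblot>y, \<lblot>y, x\<rblot>\<rblot> = 2 * (x - t * x * t)" "\<lblot>y, x + t * x * t\<rblot> = 0"
  obtains A G :: "int \<Rightarrow> 'r" where "A 0 = x" "A 1 = y"
    "\<And>k l. \<lblot>A k, A l\<rblot> = G (l - k)"
    "\<And>m k. \<lblot>G m, A k\<rblot> = 2 * (A (k - m) - A (k + m))"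
    "\<And>k z. z * x = x * z \<Longrightarrow> z * y = y * z \<Longrightarrow> z * s = s * z \<Longrightarrow> z * t = t * z \<Longrightarrow> z * A k = A k * z"
proof -
  obtain A :: "int \<Rightarrow> 'r" where A0: "A 0 = x" and A1: "A 1 = y"
    and As: "\<And>k. s * A k * s = A (- k)" and At: "\<And>k. t * A k * t = A (2 - k)"
    and central: "\<And>k z. z * x = x * z \<Longrightarrow> z * y = y * z \<Longrightarrow> z * s = s * z \<Longrightarrow> z * t = t * z \<Longrightarrow> z * A k = A k * z"
    using dihedral_orbit[OF s t sx ty] by blast
  define G where "G m = \<lblot>A 0, A m\<rblot>" for m
  have cs: "s * \<lblot>A k, A l\<rblot> * s = \<lblot>A (- k), A (- l)\<rblot>" for k l
    by (simp add: bracket_conj[OF s] As)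
  have ct: "t * \<lblot>A k, A l\<rblot> * t = \<lblot>A (2 - k), A (2 - l)\<rblot>" for k l
    by (simp add: bracket_conj[OF t] At)
  have Am1: "s * y * s = A (-1)" using As[of 1] A1 by simp
  have A2: "t * x * t = A 2" using At[of 0] A0 by simp
  have G1m: "\<lblot>A 0, A (-1)\<rblot> = - G 1"
    using xy(2) by (simp add: Am1 G_def A0 A1 bracket_simps add_eq_0_iff)
  have G12: "\<lblot>A 2, A 1\<rblot> = - G 1"
    using yx(2) bracket_skew[of "A 1" "A 2"] bracket_skew[of "A 0" "A 1"]
    by (simp add: A2 G_def A0 A1 bracket_simps add_eq_0_iff)
  have sG1: "s * G 1 * s = - G 1" using cs[of 0 1] G1m by (simp add: G_def)
  have tG1: "t * G 1 * t = - G 1" using ct[of 0 1] G12 by (simp add: G_def)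
  \<comment> \<open>A reflection reverses the adjacent pair but also negates \<open>G 1\<close>; the
    two signs cancel.\<close>
  have B1s: "\<lblot>A (- k - 1), A (- k)\<rblot> = G 1" if "\<lblot>A k, A (k + 1)\<rblot> = G 1" for k
    using cs[of k "k + 1"] that sG1 bracket_skew[of "A (- k)" "A (- k - 1)"] by simp
  have B1t: "\<lblot>A (1 - k), A (2 - k)\<rblot> = G 1" if "\<lblot>A k, A (k + 1)\<rblot> = G 1" for k
    using ct[of k "k + 1"] that tG1 bracket_skew[of "A (2 - k)" "A (1 - k)"] by simp
  have B1: "\<lblot>A k, A (k + 1)\<rblot> = G 1" for k
  proof (induction k rule: int_step2_induct)
    case 1 then show ?case by (simp add: G_def)
  next
    case 2 then show ?case using G12 bracket_skew[of "A 1" "A 2"] by simp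
  next
    case (3 k) then show ?case using B1t[of "- k - 1"] B1s[of k] by (simp add: add.commute)
  next
    case (4 k) then show ?case using B1s[of "1 - k"] B1t[of k] by (simp add: add.commute)
  qed
  let ?Q = "\<lambda>m k. \<lblot>G m, A k\<rblot> = 2 * (A (k - m) - A (k + m))"
  have Q1s: "?Q 1 (- k)" if "?Q 1 k" for k
  proof -
    have "- \<lblot>G 1, A (- k)\<rblot> = s * \<lblot>G 1, A k\<rblot> * s"
      by (simp add: bracket_conj[OF s] sG1 As bracket_simps)
    also have "\<dots> = 2 * (s * A (k - 1) * s - s * A (k + 1) * s)"
      unfolding that by (simp add: algebra_simps mult_2 mult_2_right)
    finally have "- \<lblot>G 1, A (- k)\<rblot> = 2 * (A (1 - k) - A (- k - 1))" by (simp add: As)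
    then have "\<lblot>G 1, A (- k)\<rblot> = - (2 * (A (1 - k) - A (- k - 1)))" by (metis minus_minus)
    then show ?thesis by (simp add: algebra_simps)
  qed
  have Q1t: "?Q 1 (2 - k)" if "?Q 1 k" for k
  proof -
    have "- \<lblot>G 1, A (2 - k)\<rblot> = t * \<lblot>G 1, A k\<rblot> * t"
      by (simp add: bracket_conj[OF t] tG1 At bracket_simps)
    also have "\<dots> = 2 * (t * A (k - 1) * t - t * A (k + 1) * t)"
      unfolding that by (simp add: algebra_simps mult_2 mult_2_right)
    finally have "- \<lblot>G 1, A (2 - k)\<rblot> = 2 * (A (3 - k) - A (1 - k))" by (simp add: At)
    then have "\<lblot>G 1, A (2 - k)\<rblot> = - (2 * (A (3 - k) - A (1 - k)))" by (metis minus_minus)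
    then show ?thesis by (simp add: algebra_simps)
  qed
  have Q1: "?Q 1 k" for k
  proof (induction k rule: int_step2_induct)
    case 1 show ?case using xy(1) bracket_skew[of "G 1" x]
      by (simp add: G_def A0 A1 Am1 bracket_skew[of "\<lblot>x, y\<rblot>" x])
  next
    case 2
    have "\<lblot>G 1, y\<rblot> = \<lblot>y, \<lblot>y, x\<rblot>\<rblot>" by (simp add: G_def A0 A1 bracket_def algebra_simps)
    then show ?case using yx(1) by (simp add: A0 A1 A2)
  next
    case (3 k) then show ?case using Q1t[of "- k"] Q1s[of k] by (simp add: add.commute)
  next
    case (4 k) then show ?case using Q1s[of "2 - k"] Q1t[of k] by (simp add: add.commute)
  qed
  have main: "\<forall>j\<le>m. \<forall>k. \<lblot>A k, A (k + int j)\<rblot> = G (int j) \<and> ?Q (int j) k" for m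
  proof (induction m)
    case 0 show ?case by (simp add: bracket_simps G_def)
  next
    case (Suc m)
    then have BI: "\<lblot>A k, A (k + int j)\<rblot> = G (int j)" and QI: "?Q (int j) k" if "j \<le> m" for j k
      using that by auto
    show ?case
    proof (cases "m = 0")
      case True
      then show ?thesis using BI QI B1 Q1 by (auto simp: le_Suc_eq)
    next
      case False
      let ?m = "int m"
      \<comment> \<open>\<open>D\<close> is the change of the distance \<open>m + 1\<close> bracket
        under a shift by one; the aim is \<open>D = 0\<close>.\<close>
      define D where "D = \<lblot>A 0, A (?m + 1)\<rblot> - \<lblot>A (-1), A ?m\<rblot>"
      have BI': "\<lblot>A k, A l\<rblot> = - G (k - l)" if "k \<ge> l" "k - l \<le> ?m" for k l
        using BI[of "nat (k - l)" l] that bracket_skew[of "A k" "A l"] by (simp add: nat_le_iff)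
      have BI'': "\<lblot>A k, A l\<rblot> = G (l - k)" if "k \<le> l" "l - k \<le> ?m" for k l
        using BI[of "nat (l - k)" k] that by (simp add: nat_le_iff)
      \<comment> \<open>Two terms of the Leibniz expansion have distance \<open>m - 1\<close> and
        cancel by induction, so the change under a shift does not depend on
        \<open>k\<close>.\<close>
      have GG: "\<lblot>G 1, G ?m\<rblot> = 2 * (\<lblot>A (k - 1), A (k + ?m)\<rblot> - \<lblot>A k, A (k + ?m + 1)\<rblot>)" for k
      proof -
        have "\<lblot>G 1, G ?m\<rblot> = \<lblot>\<lblot>G 1, A k\<rblot>, A (k + ?m)\<rblot> + \<lblot>A k, \<lblot>G 1, A (k + ?m)\<rblot>\<rblot>"
          unfolding BI[OF order_refl, of k, symmetric] by (rule bracket_Leibniz)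
        also have "\<dots> = 2 * (\<lblot>A (k - 1), A (k + ?m)\<rblot> - \<lblot>A (k + 1), A (k + ?m)\<rblot>
            + \<lblot>A k, A (k + ?m - 1)\<rblot> - \<lblot>A k, A (k + ?m + 1)\<rblot>)"
          unfolding Q1 by (simp add: bracket_simps algebra_simps)
        also have "\<lblot>A (k + 1), A (k + ?m)\<rblot> = \<lblot>A k, A (k + ?m - 1)\<rblot>"
          using False BI''[of "k + 1" "k + ?m"] BI''[of "k" "k + ?m - 1"] by simp
        finally show ?thesis by simp
      qed
      have tf2: "a = b" if "2 * a = 2 * b" for a b :: 'r
        using tf[of "a - b" 1] that by (simp add: mult_2 algebra_simps)
      have step: "\<lblot>A k, A (k + ?m + 1)\<rblot> = \<lblot>A (k - 1), A (k + ?m)\<rblot> + D" for k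
      proof -
        have "2 * (\<lblot>A (k - 1), A (k + ?m)\<rblot> - \<lblot>A k, A (k + ?m + 1)\<rblot>) = 2 * (- D)"
          unfolding GG[of k, symmetric] GG[of 0] by (simp add: D_def)
        from tf2[OF this] show ?thesis by (simp add: algebra_simps)
      qed
      have GD: "\<lblot>G 1, G ?m\<rblot> = - (2 * D)" using GG[of 0] by (simp add: D_def algebra_simps)
      have steps: "\<lblot>A (k + int n), A (k + int n + ?m + 1)\<rblot> = \<lblot>A k, A (k + ?m + 1)\<rblot> + (\<Sum>i<n. D)" for n k
      proof (induction n)
        case (Suc n)
        then show ?case using step[of "k + int (Suc n)"] by (simp add: algebra_simps)
      qed simp
      \<comment> \<open>Expanding \<open>G 1\<close> instead of \<open>G m\<close> evaluates this
        bracket as \<open>- 2 m D\<close>, while \<open>GD\<close> gives \<open>2 D\<close>. Hence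
        \<open>(m + 1) D = 0\<close>, and torsion-freeness applies.\<close>
      have "\<lblot>G ?m, G 1\<rblot> = \<lblot>\<lblot>G ?m, A 0\<rblot>, A 1\<rblot> + \<lblot>A 0, \<lblot>G ?m, A 1\<rblot>\<rblot>"
        unfolding G_def[of 1] by (rule bracket_Leibniz)
      also have "\<dots> = 2 * (\<lblot>A (- ?m), A 1\<rblot> - \<lblot>A ?m, A 1\<rblot> + \<lblot>A 0, A (1 - ?m)\<rblot> - \<lblot>A 0, A (?m + 1)\<rblot>)"
        unfolding QI[OF order_refl] by (simp add: bracket_simps algebra_simps)
      also have "\<lblot>A 0, A (1 - ?m)\<rblot> = \<lblot>A ?m, A 1\<rblot>"
        using False BI'[of "1 - ?m" 0] BI'[of 1 ?m] by simp
      also have "\<lblot>A 0, A (?m + 1)\<rblot> = \<lblot>A (- ?m), A 1\<rblot> + (\<Sum>i<m. D)"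
        using steps[of "- ?m" m] by simp
      finally have "2 * D = - (2 * ((\<Sum>i<m. D)))"
        using GD bracket_skew[of "G ?m" "G 1"] by simp
      then have "2 * ((\<Sum>i\<le>m. D)) = 2 * 0" by (simp add: lessThan_Suc_atMost[symmetric] algebra_simps)
      from tf2[OF this] have D0: "D = 0" using tf[of D m] by simp
      have BS: "\<lblot>A k, A (k + ?m + 1)\<rblot> = G (?m + 1)" for k
      proof (cases "k \<ge> 0")
        case True then show ?thesis using steps[of 0 "nat k"] D0 by (simp add: G_def)
      next
        case False then show ?thesis using steps[of k "nat (- k)"] D0 by (simp add: G_def)
      qed
      \<comment> \<open>With \<open>G (m + 1)\<close> written as a bracket starting at
        \<open>k - 1\<close>, the Jacobi identity with \<open>A k\<close> leaves inner brackets of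
        distances \<open>m\<close> and 1.\<close>
      have QS: "?Q (?m + 1) k" for k
      proof -
        have "\<lblot>G (?m + 1), A k\<rblot> = \<lblot>\<lblot>A (k - 1), A (k + ?m)\<rblot>, A k\<rblot>"
          using BS[of "k - 1"] by simp
        also have "\<dots> = \<lblot>A (k - 1), \<lblot>A (k + ?m), A k\<rblot>\<rblot> - \<lblot>A (k + ?m), \<lblot>A (k - 1), A k\<rblot>\<rblot>"
          using bracket_Leibniz[of "A (k - 1)" "A (k + ?m)" "A k"] by simp
        also have "\<lblot>A (k + ?m), A k\<rblot> = - G ?m" using BI'[of k "k + ?m"] by simp
        also have "\<lblot>A (k - 1), A k\<rblot> = G 1" using B1[of "k - 1"] by simp
        also have "\<lblot>A (k - 1), - G ?m\<rblot> = \<lblot>G ?m, A (k - 1)\<rblot>"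
          using bracket_skew[of "A (k - 1)" "G ?m"] by (simp add: bracket_simps)
        also have "\<lblot>A (k + ?m), G 1\<rblot> = - \<lblot>G 1, A (k + ?m)\<rblot>" by (rule bracket_skew)
        finally show ?thesis using Q1[of "k + ?m"] QI[OF order_refl, of "k - 1"]
          by (simp add: algebra_simps)
      qed
      show ?thesis using BI QI BS QS by (auto simp: le_Suc_eq algebra_simps)
    qed
  qed
  have AAp: "\<lblot>A k, A (k + int j)\<rblot> = G (int j)" and GAp: "?Q (int j) k" for j k
    using main[of j] by auto
  have Gm: "G (- int j) = - G (int j)" for j
    using AAp[of "- int j" j] bracket_skew[of "A 0" "A (- int j)"] by (simp add: G_def)
  have "\<lblot>A k, A l\<rblot> = G (l - k)" for k l
  proof (cases "k \<le> l")
    case True then show ?thesis using AAp[of k "nat (l - k)"] by simp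
  next
    case False then show ?thesis
      using AAp[of l "nat (k - l)"] Gm[of "nat (k - l)"] bracket_skew[of "A k" "A l"] by simp
  qed
  moreover have "?Q m k" for m k
  proof (cases "m \<ge> 0")
    case True then show ?thesis using GAp[of "nat m" k] by simp
  next
    case False then show ?thesis using GAp[of "nat (- m)" k] Gm[of "nat (- m)"]
      by (simp add: bracket_simps algebra_simps)
  qed
  ultimately show ?thesis using that A0 A1 central by blast
qed

text \<open>\<open>H\<close>, \<open>E\<close>, \<open>F\<close> are the parts of weight 0, 2 and -2
  for the bracket with \<open>A 1\<close>, where \<open>H 0 = 2 * A 1\<close>. All brackets expand
  through \<open>AA\<close> and \<open>GA\<close>; in the index, \<open>G\<close>, \<open>E\<close>,
  \<open>F\<close> are odd and \<open>H\<close> is even.\<close>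

lemma Onsager_triangular:
  fixes A G :: "int \<Rightarrow> 'r::{ring,semiring_numeral}"
  assumes
    AA: "\<And>k l. \<lblot>A k, A l\<rblot> = G (l - k)"
    and GA: "\<And>m k. \<lblot>G m, A k\<rblot> = 2 * (A (k - m) - A (k + m))"
  defines "H m \<equiv> A (1 + m) + A (1 - m)"
    and "E m \<equiv> A (1 + m) - A (1 - m) + G m"
    and "F m \<equiv> A (1 + m) - A (1 - m) - G m"
  shows "\<lblot>H m, H n\<rblot> = 0"
    and "\<lblot>H m, E n\<rblot> = 2 * (E (n + m) + E (n - m))"
    and "\<lblot>H m, F n\<rblot> = - (2 * (F (n + m) + F (n - m)))"
    and "\<lblot>E m, F n\<rblot> = 4 * (H (m - n) - H (m + n))"
proof -
  have Gm: "G (- k) = - G k" for k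
    using AA[of 0 k] AA[of k 0] bracket_skew[of "A k" "A 0"] by simp
  have AG: "\<lblot>A k, G m\<rblot> = 2 * (A (k + m) - A (k - m))" for k m
    using GA[of m k] bracket_skew[of "A k" "G m"] by (simp add: right_diff_distrib)
  have GG: "\<lblot>G m, G n\<rblot> = 0" for m n
  proof -
    have "\<lblot>G m, G n\<rblot> = \<lblot>\<lblot>G m, A 0\<rblot>, A n\<rblot> + \<lblot>A 0, \<lblot>G m, A n\<rblot>\<rblot>"
      using bracket_Leibniz[of "G m" "A 0" "A n"] AA[of 0 n] by simp
    then show ?thesis by (simp add: GA bracket_simps AA add.commute)
  qed
  have G_norm: "G (k - l) = - G (l - k)" for k l using Gm[of "l - k"] by simp
  show "\<lblot>H m, H n\<rblot> = 0"
    using Gm[of "n + m"] G_norm[of m n] by (simp add: H_def bracket_simps AA algebra_simps)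
  show "\<lblot>H m, E n\<rblot> = 2 * (E (n + m) + E (n - m))"
    using Gm[of "n + m"] G_norm[of m n]
    by (simp add: H_def E_def bracket_simps AA AG algebra_simps mult_2)
  show "\<lblot>H m, F n\<rblot> = - (2 * (F (n + m) + F (n - m)))"
    using Gm[of "n + m"] G_norm[of m n]
    by (simp add: H_def F_def bracket_simps AA AG algebra_simps mult_2)
  have four: "4 * c = c + c + c + c" for c :: 'r
    using distrib_right[of 2 2 c] by (simp add: mult_2)
  show "\<lblot>E m, F n\<rblot> = 4 * (H (m - n) - H (m + n))"
    using Gm[of "n + m"] G_norm[of m n] unfolding four
    by (simp add: H_def E_def F_def bracket_simps AA AG GA GG algebra_simps mult_2)
qed

section \<open>The ring of additive endomorphisms\<close>

text \<open>Asking only for additivity keeps the type independent of \<open>scale\<close>. Linearity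
  is recovered later by treating scalar multiplications as elements that commute with the
  generators.\<close>

typedef (overloaded) 'w endo = "{f :: 'w::ab_group_add \<Rightarrow> 'w. \<forall>u v. f (u + v) = f u + f v}"
  morphisms app Endo
  by (rule exI[of _ "\<lambda>_. 0"]) simp

setup_lifting type_definition_endo

instantiation endo :: (ab_group_add) "{ring, semiring_numeral}"
begin

lift_definition zero_endo :: "'a endo" is "\<lambda>_. 0" by simp
lift_definition one_endo :: "'a endo" is "\<lambda>v. v" by simp
lift_definition plus_endo :: "'a endo \<Rightarrow> 'a endo \<Rightarrow> 'a endo" is "\<lambda>f g v. f v + g v"
  by (simp add: algebra_simps)
lift_definition minus_endo :: "'a endo \<Rightarrow> 'a endo \<Rightarrow> 'a endo" is "\<lambda>f g v. f v - g v"
  by (simp add: algebra_simps)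
lift_definition uminus_endo :: "'a endo \<Rightarrow> 'a endo" is "\<lambda>f v. - f v"
  by simp
lift_definition times_endo :: "'a endo \<Rightarrow> 'a endo \<Rightarrow> 'a endo" is "\<lambda>f g v. f (g v)"
  by simp

instance
  by standard (transfer; simp add: fun_eq_iff algebra_simps)+

end

lemma app_add [simp]: "app X (u + v) = app X u + app X v"
  by transfer simp

lemma app_plus [simp]: "app (X + Y) v = app X v + app Y v"
  by transfer simp

lemma app_minus [simp]: "app (X - Y) v = app X v - app Y v"
  by transfer simp

lemma app_uminus [simp]: "app (- X) v = - app X v"
  by transfer simp

lemma app_times [simp]: "app (X * Y) v = app X (app Y v)"
  by transfer simp

lemma app_zero [simp]: "app 0 v = 0"
  by transfer simp

lemma app_one [simp]: "app 1 v = v"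
  by transfer simp

lemma app_sum: "app (\<Sum>i\<in>I. X i) v = (\<Sum>i\<in>I. app (X i) v)"
  by (induction I rule: infinite_finite_induct) simp_all

lemma endo_eqI: "(\<And>v. app X v = app Y v) \<Longrightarrow> X = Y"
  by (simp add: app_inject[symmetric] fun_eq_iff)

lemma app_Endo: "(\<And>u v. f (u + v) = f u + f v) \<Longrightarrow> app (Endo f) = f"
  by (simp add: Endo_inverse)

section \<open>Polynomials in a linear operator\<close>

lemma interpolation_poly:
  fixes c :: "'b \<Rightarrow> 'a::field"
  assumes "finite I" "inj_on \<theta> I"
  shows "\<exists>p. \<forall>i\<in>I. poly p (\<theta> i) = c i"
  using assms
proof (induction I rule: finite_induct)
  case (insert j I)
  then obtain p where p: "\<forall>i\<in>I. poly p (\<theta> i) = c i" by auto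
  let ?q = "\<Prod>i\<in>I. [:- \<theta> i, 1:]"
  have q0: "poly ?q (\<theta> i) = 0" if "i \<in> I" for i
    using insert.hyps that by (auto simp: poly_prod)
  have qj: "poly ?q (\<theta> j) \<noteq> 0"
    using insert by (auto simp: poly_prod image_iff)
  let ?p = "p + smult ((c j - poly p (\<theta> j)) / poly ?q (\<theta> j)) ?q"
  have "\<forall>i\<in>insert j I. poly ?p (\<theta> i) = c i"
    using p q0 qj by simp
  then show ?case by blast
qed simp

locale fin_dim_space = finite_dimensional_vector_space scale Basis
  for scale :: "'a::field \<Rightarrow> 'b::ab_group_add \<Rightarrow> 'b" and Basis
begin

lemma
  assumes "Vector_Spaces.linear scale scale X"
  shows operator_0: "X 0 = 0" and operator_add: "X (u + v) = X u + X v"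
    and operator_diff: "X (u - v) = X u - X v" and operator_scale: "X (scale c v) = scale c (X v)"
proof -
  interpret X: Vector_Spaces.linear scale scale X by fact
  show "X 0 = 0" "X (u + v) = X u + X v" "X (u - v) = X u - X v" "X (scale c v) = scale c (X v)"
    by (fact X.zero X.add X.diff X.scale)+
qed

definition poly_op :: "'a poly \<Rightarrow> ('b \<Rightarrow> 'b) \<Rightarrow> 'b \<Rightarrow> 'b" where
  "poly_op p X = fold_coeffs (\<lambda>a g v. scale a v + X (g v)) p (\<lambda>_. 0)"

lemma poly_op_0 [simp]: "poly_op 0 X v = 0"
  by (simp add: poly_op_def)

lemma poly_op_pCons:
  assumes "Vector_Spaces.linear scale scale X"
  shows "poly_op (pCons a p) X v = scale a v + X (poly_op p X v)"
proof -
  interpret X: Vector_Spaces.linear scale scale X by fact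
  show ?thesis
    by (cases "p = 0 \<and> a = 0") (auto simp: poly_op_def X.zero)
qed

lemma poly_op_linear:
  assumes "Vector_Spaces.linear scale scale X"
  shows "Vector_Spaces.linear scale scale (poly_op p X)"
proof -
  interpret X: Vector_Spaces.linear scale scale X by fact
  have "poly_op p X (u + v) = poly_op p X u + poly_op p X v
      \<and> poly_op p X (scale c v) = scale c (poly_op p X v)" for u v c
    by (induction p)
      (simp_all add: poly_op_pCons[OF assms] X.add X.scale scale_right_distrib mult.commute)
  then show ?thesis
    by (simp add: Vector_Spaces.linear_iff vector_space_axioms)
qed

lemma poly_op_add:
  assumes "Vector_Spaces.linear scale scale X"
  shows "poly_op (p + q) X v = poly_op p X v + poly_op q X v"
proof -
  interpret X: Vector_Spaces.linear scale scale X by fact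
  show ?thesis
    by (induction p q rule: poly_induct2)
      (simp_all add: poly_op_pCons[OF assms] X.add scale_left_distrib)
qed

lemma poly_op_smult:
  assumes "Vector_Spaces.linear scale scale X"
  shows "poly_op (smult c p) X v = scale c (poly_op p X v)"
proof -
  interpret X: Vector_Spaces.linear scale scale X by fact
  show ?thesis
    by (induction p) (simp_all add: poly_op_pCons[OF assms] X.scale scale_right_distrib)
qed

lemma poly_op_root_factor:
  assumes "Vector_Spaces.linear scale scale X"
  shows "poly_op ([:- r, 1:] * q) X v = X (poly_op q X v) - scale r (poly_op q X v)"
proof -
  have "[:- r, 1:] * q = smult (- r) q + pCons 0 q" by simp
  then show ?thesis
    by (simp only: poly_op_add[OF assms] poly_op_smult[OF assms] poly_op_pCons[OF assms]) simp
qed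

lemma poly_op_monom:
  assumes "Vector_Spaces.linear scale scale X"
  shows "poly_op (monom c n) X v = scale c ((X ^^ n) v)"
proof -
  interpret X: Vector_Spaces.linear scale scale X by fact
  show ?thesis
    by (induction n) (simp_all add: monom_0 monom_Suc poly_op_pCons[OF assms] X.zero X.scale)
qed

lemma poly_op_sum:
  assumes "Vector_Spaces.linear scale scale X"
  shows "poly_op (\<Sum>i\<in>I. p i) X v = (\<Sum>i\<in>I. poly_op (p i) X v)"
  by (induction I rule: infinite_finite_induct) (simp_all add: poly_op_add[OF assms])

lemma poly_op_eigenvector:
  assumes "Vector_Spaces.linear scale scale X" "X v = scale r v"
  shows "poly_op p X v = scale (poly p r) v"
proof -
  interpret X: Vector_Spaces.linear scale scale X by fact
  show ?thesis
    by (induction p)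
      (simp_all add: poly_op_pCons[OF assms(1)] X.scale assms(2) scale_left_distrib mult.commute)
qed

lemma poly_op_in_subspace:
  assumes "Vector_Spaces.linear scale scale X" "subspace U" "X ` U \<subseteq> U" "v \<in> U"
  shows "poly_op p X v \<in> U"
  using assms(2-)
  by (induction p) (auto simp: poly_op_pCons[OF assms(1)] subspace_0 subspace_add subspace_scale)

text \<open>The iterates \<open>(X ^^ n) v\<close> either repeat or form an infinite, hence
  dependent, set. The cases are separated because dependence of a set does not see
  repetitions.\<close>

lemma annihilating_poly:
  assumes X: "Vector_Spaces.linear scale scale X"
  shows "\<exists>p. p \<noteq> 0 \<and> poly_op p X v = 0"
proof (cases "inj (\<lambda>n. (X ^^ n) v)")
  case False
  then obtain m n where mn: "m \<noteq> n" "(X ^^ m) v = (X ^^ n) v" by (auto simp: inj_def)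
  let ?p = "monom (1::'a) m + smult (- 1) (monom 1 n)"
  have "coeff ?p m = 1" using mn by simp
  then have "?p \<noteq> 0" by (metis coeff_0 zero_neq_one)
  moreover have "poly_op ?p X v = 0"
    using mn by (simp only: poly_op_add[OF X] poly_op_smult[OF X] poly_op_monom[OF X]) simp
  ultimately show ?thesis by blast
next
  case True
  let ?b = "\<lambda>n. (X ^^ n) v"
  have "infinite (range ?b)" using True by (rule range_inj_infinite)
  then have "dependent (range ?b)" using finiteI_independent by blast
  then obtain T u where T: "finite T" "T \<subseteq> range ?b" "(\<Sum>w\<in>T. scale (u w) w) = 0" "\<exists>w\<in>T. u w \<noteq> 0"
    unfolding dependent_explicit by auto
  obtain I where I: "finite I" "T = ?b ` I" using finite_subset_image[OF T(1,2)] by auto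
  have inj: "inj_on ?b I" using True inj_on_subset by blast
  let ?p = "\<Sum>i\<in>I. monom (u (?b i)) i"
  obtain i where i: "i \<in> I" "u (?b i) \<noteq> 0" using T(4) I by auto
  have "coeff ?p i = (\<Sum>j\<in>I. if j = i then u (?b j) else 0)"
    by (simp add: coeff_sum)
  also have "\<dots> = u (?b i)" using I i by simp
  finally have "?p \<noteq> 0" using i by (metis coeff_0)
  moreover have "poly_op ?p X v = 0"
    using T(3) by (simp add: poly_op_sum[OF X] poly_op_monom[OF X] I sum.reindex[OF inj])
  ultimately show ?thesis by blast
qed

end

section \<open>Eigenvectors over an algebraically closed field\<close>

locale alg_closed_fin_dim_space = fin_dim_space scale Basis
  for scale :: "'a::alg_closed_field \<Rightarrow> 'b::ab_group_add \<Rightarrow> 'b" and Basis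
begin

text \<open>Split a root \<open>r\<close> off \<open>p\<close>, leaving \<open>q\<close>. If
  \<open>q\<close> does not annihilate \<open>v\<close>, then \<open>poly_op q X v\<close> is an
  eigenvector for \<open>r\<close>; otherwise descend to \<open>q\<close>.\<close>

lemma eigenvector_of_annihilating_poly:
  assumes X: "Vector_Spaces.linear scale scale X" and U: "subspace U" "X ` U \<subseteq> U"
    and "p \<noteq> 0" "v \<in> U" "v \<noteq> 0" "poly_op p X v = 0"
  shows "\<exists>r. \<exists>w\<in>U. w \<noteq> 0 \<and> X w = scale r w"
  using assms(4-)
proof (induction "degree p" arbitrary: p)
  case 0
  then obtain c where "p = [:c:]" using degree_eq_zeroE by metis
  then show ?case using 0 by (auto simp: poly_op_pCons[OF X] operator_0[OF X])
next
  case (Suc n)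
  then obtain r where "poly p r = 0" using alg_closed_imp_poly_has_root[of p] by auto
  then obtain q where q: "p = [:- r, 1:] * q" using poly_eq_0_iff_dvd by (metis dvdE)
  then have "q \<noteq> 0" using Suc by auto
  then have deg: "n = degree q" using Suc(2) q by (simp add: degree_mult_eq del: mult_pCons_left)
  show ?case
  proof (cases "poly_op q X v = 0")
    case True
    then show ?thesis using Suc(1)[OF deg] \<open>q \<noteq> 0\<close> Suc by blast
  next
    case False
    moreover have "poly_op q X v \<in> U" using poly_op_in_subspace[OF X U] Suc by blast
    moreover have "X (poly_op q X v) = scale r (poly_op q X v)"
      using Suc q by (simp only: poly_op_root_factor[OF X]) simp
    ultimately show ?thesis by blast
  qed
qed

text \<open>Induction on the dimension: if some \<open>X i\<close> is not a scalar on
  \<open>U\<close>, one of its eigenspaces in \<open>U\<close> is nonzero, proper and, by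
  commutation, invariant under the whole family.\<close>

lemma common_eigenvector:
  assumes X: "\<And>i. Vector_Spaces.linear scale scale (X i)"
    and comm: "\<And>i j v. X i (X j v) = X j (X i v)"
    and U: "subspace U" "\<And>i. X i ` U \<subseteq> U" "U \<noteq> {0}"
  shows "\<exists>v\<in>U. v \<noteq> 0 \<and> (\<forall>i. \<exists>r. X i v = scale r v)"
  using U
proof (induction "dim U" arbitrary: U rule: less_induct)
  case less
  obtain v where v: "v \<in> U" "v \<noteq> 0" using less.prems subspace_0 by blast
  show ?case
  proof (cases "\<forall>i. \<exists>r. \<forall>w\<in>U. X i w = scale r w")
    case True then show ?thesis using v by blast
  next
    case False
    then obtain i where i: "\<And>r. \<exists>w\<in>U. X i w \<noteq> scale r w" by blast
    obtain p where "p \<noteq> 0" "poly_op p (X i) v = 0" using annihilating_poly[OF X] by blast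
    then obtain r w where w: "w \<in> U" "w \<noteq> 0" "X i w = scale r w"
      using eigenvector_of_annihilating_poly[OF X less.prems(1,2) _ v] by blast
    define W where "W = {w \<in> U. X i w = scale r w}"
    have sub: "subspace W"
      using less.prems(1) unfolding subspace_def W_def
      by (auto simp: operator_0[OF X] operator_add[OF X] operator_scale[OF X] scale_right_distrib mult.commute)
    have inv: "X j ` W \<subseteq> W" for j
      using less.prems(2) by (auto simp: W_def comm[of i j] operator_scale[OF X])
    have "W \<subset> U" using i[of r] by (auto simp: W_def)
    then have "dim W < dim U" using sub less.prems(1)
      by (metis dim_psubset span_eq_iff)
    moreover have "W \<noteq> {0}" using w by (auto simp: W_def)
    ultimately obtain v where "v \<in> W" "v \<noteq> 0" "\<forall>i. \<exists>r. X i v = scale r v"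
      using less.hyps sub inv by blast
    then show ?thesis by (auto simp: W_def)
  qed
qed

end

section \<open>The Onsager action of a Krawtchouk pair\<close>

text \<open>One half of the Krawtchouk hypothesis, freed from the ordering: the neighbours of the
  eigenvalue \<open>r\<close> are \<open>r + 2\<close> and \<open>r - 2\<close>. At the ends of the
  spectrum \<open>spectrum\<close> forces the missing component to be 0.\<close>

locale krawtchouk_tridiagonal = alg_closed_fin_dim_space scale Basis
  for scale :: "'a::{alg_closed_field,field_char_0} \<Rightarrow> 'b::ab_group_add \<Rightarrow> 'b" and Basis +
  fixes X Y :: "'b \<Rightarrow> 'b" and d :: nat
  assumes linear_X: "Vector_Spaces.linear scale scale X"
    and linear_Y: "Vector_Spaces.linear scale scale Y"
    and span_eigenvectors: "span {v. \<exists>r. X v = scale r v} = UNIV"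
    and spectrum: "X v = scale r v \<Longrightarrow> v \<noteq> 0 \<Longrightarrow> \<exists>i\<le>d. r = of_nat d - 2 * of_nat i"
    and tridiagonal: "X v = scale r v \<Longrightarrow>
      \<exists>a b c. Y v = a + b + c \<and> X a = scale (r + 2) a \<and> X b = scale r b \<and> X c = scale (r - 2) c"
begin

lemma operator_eqI:
  assumes "\<And>u v. f (u + v) = f u + f v" "\<And>c v. f (scale c v) = scale c (f v)"
    and "\<And>u v. g (u + v) = g u + g v" "\<And>c v. g (scale c v) = scale c (g v)"
    and "\<And>v r. X v = scale r v \<Longrightarrow> f v = g v"
  shows "f v = (g v :: 'b)"
proof -
  have f0: "f 0 = 0" and g0: "g 0 = 0" using assms(2)[of 0 0] assms(4)[of 0 0] by simp_all
  have "v \<in> span {v. \<exists>r. X v = scale r v}" by (simp add: span_eigenvectors)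
  then show ?thesis
  proof (induction rule: span_induct_alt)
    case base show ?case by (simp add: f0 g0)
  next
    case (step c x y)
    then have "f x = g x" using assms(5) by auto
    then show ?case using step by (simp add: assms)
  qed
qed

lemma interpolating_operator:
  obtains S where "Vector_Spaces.linear scale scale S"
    "\<And>v i. i \<le> d \<Longrightarrow> X v = scale (of_nat d - 2 * of_nat i) v \<Longrightarrow> S v = scale (c i) v"
proof -
  have "inj_on (\<lambda>i. of_nat d - 2 * of_nat i :: 'a) {..d}" by (auto simp: inj_on_def)
  then obtain p where "\<forall>i\<in>{..d}. poly p (of_nat d - 2 * of_nat i) = c i"
    using interpolation_poly[of "{..d}"] by blast
  then have "poly_op p X v = scale (c i) v"
    if "i \<le> d" "X v = scale (of_nat d - 2 * of_nat i) v" for v i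
    using that poly_op_eigenvector[OF linear_X that(2), of p] by simp
  then show ?thesis by (rule that[OF poly_op_linear[OF linear_X]])
qed

text \<open>\<open>S\<close> is the sign \<open>(-1)^i\<close> on the i-th eigenspace. With
  \<open>Y v = a + b + c\<close> as in \<open>tridiagonal\<close>, conjugating \<open>Y\<close> by
  \<open>S\<close> changes the signs of \<open>a\<close> and \<open>c\<close> only. So
  \<open>Y + S Y S\<close> is twice the weight 0 part of \<open>Y\<close>, and
  \<open>Y - S Y S\<close> is twice the rest, on which the double bracket with \<open>X\<close> is
  multiplication by 4.\<close>

lemma grading_involution:
  obtains S where "Vector_Spaces.linear scale scale S" "\<And>v. S (S v) = v" "\<And>v. S (X v) = X (S v)"
    "\<And>v. X (X (Y v)) - X (Y (X v)) - (X (Y (X v)) - Y (X (X v))) = scale 2 (Y v - S (Y (S v)))"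
    "\<And>v. X (Y v + S (Y (S v))) = Y (X v) + S (Y (S (X v)))"
proof -
  obtain S where S: "Vector_Spaces.linear scale scale S"
    and sign: "\<And>v i. i \<le> d \<Longrightarrow> X v = scale (of_nat d - 2 * of_nat i) v \<Longrightarrow> S v = scale ((- 1) ^ i) v"
    using interpolating_operator[of "\<lambda>i. (- 1) ^ i"] by blast
  note ops = operator_0[OF linear_X] operator_add[OF linear_X] operator_diff[OF linear_X]
    operator_scale[OF linear_X] operator_0[OF linear_Y] operator_add[OF linear_Y]
    operator_diff[OF linear_Y] operator_scale[OF linear_Y]
    operator_0[OF S] operator_add[OF S] operator_diff[OF S] operator_scale[OF S]
  have eigen: "\<exists>e a b c. e * e = 1 \<and> S v = scale e v \<and> Y v = a + b + c
      \<and> X a = scale (r + 2) a \<and> X b = scale r b \<and> X c = scale (r - 2) c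
      \<and> S a = - scale e a \<and> S b = scale e b \<and> S c = - scale e c" if v: "X v = scale r v" for v r
  proof (cases "v = 0")
    case True
    then show ?thesis by (intro exI[of _ 1] exI[of _ 0]) (simp add: ops)
  next
    case False
    then obtain i where i: "i \<le> d" "r = of_nat d - 2 * of_nat i" using spectrum v by blast
    obtain a b c where abc: "Y v = a + b + c" "X a = scale (r + 2) a" "X b = scale r b"
      "X c = scale (r - 2) c" using tridiagonal[OF v] by blast
    \<comment> \<open>In characteristic 0 equal eigenvalues have equal indices, so an adjacent
      eigenvalue has an adjacent index and the opposite sign.\<close>
    have "S a = - scale ((- 1) ^ i) a"
    proof (cases "a = 0")
      case False
      then obtain j where j: "j \<le> d" "r + 2 = of_nat d - 2 * of_nat j" using spectrum abc by blast
      then have "2 * of_nat i = (2 * of_nat (Suc j) :: 'a)" using i by (simp add: algebra_simps)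
      then have "i = Suc j" by (simp only: mult_cancel_left of_nat_eq_iff) simp
      then show ?thesis using sign[of j a] j abc by simp
    qed (simp add: ops)
    moreover have "S c = - scale ((- 1) ^ i) c"
    proof (cases "c = 0")
      case False
      then obtain j where j: "j \<le> d" "r - 2 = of_nat d - 2 * of_nat j" using spectrum abc by blast
      then have "2 * of_nat j = (2 * of_nat (Suc i) :: 'a)" using i by (simp add: algebra_simps)
      then have "j = Suc i" by (simp only: mult_cancel_left of_nat_eq_iff) simp
      then show ?thesis using sign[of j c] j abc by simp
    qed (simp add: ops)
    moreover have "S v = scale ((- 1) ^ i) v" "S b = scale ((- 1) ^ i) b"
      using sign i v abc by auto
    moreover have "(- 1) ^ i * (- 1) ^ i = (1 :: 'a)" by (simp add: power_mult_distrib[symmetric])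
    ultimately show ?thesis using abc by blast
  qed
  have two: "scale 2 v = v + v" for v using scale_left_distrib[of 1 1 v] by simp
  have SS: "S (S v) = v" for v
    by (rule operator_eqI) (use eigen in \<open>fastforce simp: ops\<close>)+
  have SX: "S (X v) = X (S v)" for v
    by (rule operator_eqI) (use eigen in \<open>fastforce simp: ops mult.commute\<close>)+
  have DG: "X (X (Y v)) - X (Y (X v)) - (X (Y (X v)) - Y (X (X v))) = scale 2 (Y v - S (Y (S v)))" for v
  proof (rule operator_eqI[where f = "\<lambda>v. X (X (Y v)) - X (Y (X v)) - (X (Y (X v)) - Y (X (X v)))"])
    fix v r assume v: "X v = scale r v"
    obtain e a b c where abc: "e * e = 1" "S v = scale e v" "Y v = a + b + c"
      "X a = scale (r + 2) a" "X b = scale r b" "X c = scale (r - 2) c"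
      "S a = - scale e a" "S b = scale e b" "S c = - scale e c" using eigen[OF v] by blast
    \<comment> \<open>The eigenvalues adjacent to \<open>r\<close>. The double bracket multiplies
      \<open>a\<close> by \<open>(p - r)^2 = 4\<close> and \<open>c\<close> by
      \<open>(q - r)^2 = 4\<close>, and annihilates \<open>b\<close>.\<close>
    define p q where "p = r + 2" and "q = r - 2"
    have "X (X (Y v)) - X (Y (X v)) - (X (Y (X v)) - Y (X (X v)))
        = (scale (p * p) a - scale (p * r) a - (scale (p * r) a - scale (r * r) a))
          + (scale (q * q) c - scale (q * r) c - (scale (q * r) c - scale (r * r) c))"
      by (simp add: v abc ops scale_right_distrib mult.commute flip: p_def q_def)
    moreover have "p * p - p * r - (p * r - r * r) = 4" "q * q - q * r - (q * r - r * r) = 4"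
      by (simp_all add: p_def q_def algebra_simps)
    ultimately have "X (X (Y v)) - X (Y (X v)) - (X (Y (X v)) - Y (X (X v))) = scale 4 (a + c)"
      by (simp add: scale_right_distrib flip: scale_left_diff_distrib)
    moreover have "S (Y (S v)) = b - a - c"
      by (simp add: abc ops scale_right_distrib scale_right_diff_distrib)
    moreover have "scale 4 (a + c) = scale 2 (a + c) + scale 2 (a + c)"
      using scale_left_distrib[of 2 2 "a + c"] by simp
    ultimately show "X (X (Y v)) - X (Y (X v)) - (X (Y (X v)) - Y (X (X v))) = scale 2 (Y v - S (Y (S v)))"
      by (simp add: abc two)
  qed (simp_all add: ops algebra_simps)
  have XD: "X (Y v + S (Y (S v))) = Y (X v) + S (Y (S (X v)))" for v
  proof (rule operator_eqI[where f = "\<lambda>v. X (Y v + S (Y (S v)))"])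
    fix v r assume v: "X v = scale r v"
    obtain e a b c where abc: "e * e = 1" "S v = scale e v" "Y v = a + b + c"
      "X a = scale (r + 2) a" "X b = scale r b" "X c = scale (r - 2) c"
      "S a = - scale e a" "S b = scale e b" "S c = - scale e c" using eigen[OF v] by blast
    have "S (Y (S v)) = b - a - c"
      by (simp add: abc ops scale_right_distrib scale_right_diff_distrib)
    then show "X (Y v + S (Y (S v))) = Y (X v) + S (Y (S (X v)))"
      by (simp add: v ops) (simp add: abc ops scale_right_distrib[symmetric])
  qed (simp_all add: ops algebra_simps)
  show ?thesis using that S SS SX DG XD by blast
qed

text \<open>The spectral projection for the eigenvalue \<open>d\<close>. Taken for \<open>Y\<close>,
  it will supply the highest weight functional.\<close>

lemma top_projection:
  obtains P where "Vector_Spaces.linear scale scale P"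
    "\<And>v. X v = scale (of_nat d) v \<Longrightarrow> P v = v"
    "\<And>v r. X v = scale r v \<Longrightarrow> r \<noteq> of_nat d \<Longrightarrow> P v = 0"
proof -
  obtain P where P: "Vector_Spaces.linear scale scale P"
    and Pc: "\<And>v i. i \<le> d \<Longrightarrow> X v = scale (of_nat d - 2 * of_nat i) v
      \<Longrightarrow> P v = scale (if i = 0 then 1 else 0) v"
    using interpolating_operator[of "\<lambda>i. if i = 0 then 1 else 0"] by blast
  show ?thesis
  proof (rule that[OF P])
    show "P v = v" if "X v = scale (of_nat d) v" for v using Pc[of 0 v] that by simp
    show "P v = 0" if v: "X v = scale r v" "r \<noteq> of_nat d" for v r
    proof (cases "v = 0")
      case False
      then obtain i where "i \<le> d" "r = of_nat d - 2 * of_nat i" using spectrum v by blast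
      then show ?thesis using Pc[of i v] v by (cases "i = 0") auto
    qed (simp add: operator_0[OF P])
  qed
qed

end

text \<open>\<open>spectrum\<close> only confines the eigenvalues; \<open>top_eigenvector\<close>
  adds that \<open>d\<close> occurs, so that a highest weight vector exists.\<close>

locale krawtchouk_pair =
  krawtchouk_tridiagonal scale Basis X Y d + flip: krawtchouk_tridiagonal scale Basis Y X d
  for scale :: "'a::{alg_closed_field,field_char_0} \<Rightarrow> 'b::ab_group_add \<Rightarrow> 'b" and Basis X Y d +
  assumes irreducible: "subspace W \<Longrightarrow> X ` W \<subseteq> W \<Longrightarrow> Y ` W \<subseteq> W \<Longrightarrow> W = {0} \<or> W = UNIV"
    and top_eigenvector: "\<exists>v. v \<noteq> 0 \<and> Y v = scale (of_nat d) v"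

text \<open>Transposition reverses products, and exchanging \<open>E\<close> with \<open>F\<close>
  at the same time restores these relations; \<open>H_uminus\<close> absorbs the resulting sign of
  the index in \<open>E_F\<close>.\<close>

locale triangular_action = fin_dim_space scale Basis
  for scale :: "'a::field \<Rightarrow> 'b::ab_group_add \<Rightarrow> 'b" and Basis +
  fixes H E F :: "int \<Rightarrow> 'b \<Rightarrow> 'b"
  assumes linear_H: "Vector_Spaces.linear scale scale (H m)"
    and linear_E: "Vector_Spaces.linear scale scale (E m)"
    and linear_F: "Vector_Spaces.linear scale scale (F m)"
    and H_uminus: "H (- m) v = H m v"
    and H_H: "H m (H n v) = H n (H m v)"
    and H_E: "H m (E n v) = E n (H m v) + scale 2 (E (n + m) v + E (n - m) v)"
    and H_F: "H m (F n v) = F n (H m v) - scale 2 (F (n + m) v + F (n - m) v)"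
    and E_F: "E m (F n v) = F n (E m v) + scale 4 (H (m - n) v - H (m + n) v)"

lemma (in krawtchouk_pair) triangular_action_exists:
  obtains H E F where "triangular_action scale Basis H E F"
    "\<And>v. H 0 v = scale 2 (Y v)" "\<And>v. scale 4 (X v) = scale 2 (H 1 v) - (E 1 v + F 1 v)"
proof -
  obtain S where S: "Vector_Spaces.linear scale scale S" "\<And>v. S (S v) = v" "\<And>v. S (X v) = X (S v)"
    "\<And>v. X (X (Y v)) - X (Y (X v)) - (X (Y (X v)) - Y (X (X v))) = scale 2 (Y v - S (Y (S v)))"
    "\<And>v. X (Y v + S (Y (S v))) = Y (X v) + S (Y (S (X v)))"
    using grading_involution by blast
  obtain T where T: "Vector_Spaces.linear scale scale T" "\<And>v. T (T v) = v" "\<And>v. T (Y v) = Y (T v)"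
    "\<And>v. Y (Y (X v)) - Y (X (Y v)) - (Y (X (Y v)) - X (Y (Y v))) = scale 2 (X v - T (X (T v)))"
    "\<And>v. Y (X v + T (X (T v))) = X (Y v) + T (X (T (Y v)))"
    using flip.grading_involution by blast
  have two: "scale 2 v = v + v" for v using scale_left_distrib[of 1 1 v] by simp
  have four: "scale 4 v = v + v + (v + v)" for v
    using scale_left_distrib[of 2 2 v] by (simp add: two)
  let ?x = "Endo X" and ?y = "Endo Y" and ?s = "Endo S" and ?t = "Endo T"
  have app: "app ?x = X" "app ?y = Y" "app ?s = S" "app ?t = T" "app (Endo (scale c)) = scale c" for c
    by (simp_all add: app_Endo operator_add[OF linear_X] operator_add[OF linear_Y]
        operator_add[OF S(1)] operator_add[OF T(1)] scale_right_distrib)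
  have app2: "app 2 v = v + v" for v :: 'b using app_plus[of 1 1 v] by simp
  have tf: "Z = 0" if "(\<Sum>i\<le>n::nat. Z) = 0" for n and Z :: "'b endo"
  proof (rule endo_eqI)
    fix v
    have "scale (of_nat (Suc n)) (app Z v) = (\<Sum>i\<le>n. app Z v)"
      using sum_constant_scale[of "app Z v" "{..n}"] by simp
    also have "\<dots> = 0" using that app_sum[of "\<lambda>_. Z" "{..n}" v] by simp
    finally show "app Z v = app 0 v"
      unfolding scale_eq_0_iff of_nat_eq_0_iff by simp
  qed
  have rel: "?s * ?s = 1" "?t * ?t = 1" "?s * ?x = ?x * ?s" "?t * ?y = ?y * ?t"
    by (rule endo_eqI; simp add: app S T)+
  have DG: "\<lblot>?x, \<lblot>?x, ?y\<rblot>\<rblot> = 2 * (?y - ?s * ?y * ?s)" "\<lblot>?x, ?y + ?s * ?y * ?s\<rblot> = 0"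
    "\<lblot>?y, \<lblot>?y, ?x\<rblot>\<rblot> = 2 * (?x - ?t * ?x * ?t)" "\<lblot>?y, ?x + ?t * ?x * ?t\<rblot> = 0"
    using S(4,5) T(4,5)
    by (auto intro!: endo_eqI simp: app app2 bracket_def two operator_diff[OF linear_X] operator_diff[OF linear_Y])
  obtain A G :: "int \<Rightarrow> 'b endo" where A0: "A 0 = ?x" and A1: "A 1 = ?y"
    and AA: "\<And>k l. \<lblot>A k, A l\<rblot> = G (l - k)"
    and GA: "\<And>m k. \<lblot>G m, A k\<rblot> = 2 * (A (k - m) - A (k + m))"
    and central: "\<And>k z. z * ?x = ?x * z \<Longrightarrow> z * ?y = ?y * z \<Longrightarrow> z * ?s = ?s * z \<Longrightarrow> z * ?t = ?t * z
      \<Longrightarrow> z * A k = A k * z"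
    by (rule Onsager_relations[OF tf rel DG]) (assumption, blast)
  \<comment> \<open>Multiplication by \<open>c\<close> is an additive endomorphism commuting with
    \<open>X\<close>, \<open>Y\<close>, \<open>S\<close> and \<open>T\<close>, hence with every
    \<open>A k\<close>.\<close>
  have A_scale: "app (A k) (scale c v) = scale c (app (A k) v)" for k c v
  proof -
    have "Endo (scale c) * A k = A k * Endo (scale c)"
      by (rule central; rule endo_eqI; simp add: app operator_scale[OF linear_X]
          operator_scale[OF linear_Y] operator_scale[OF S(1)] operator_scale[OF T(1)])
    then have "app (Endo (scale c) * A k) v = app (A k * Endo (scale c)) v" by simp
    then show ?thesis by (simp add: app)
  qed
  have G_scale: "app (G k) (scale c v) = scale c (app (G k) v)" for k c v
    using AA[of 0 k, symmetric] by (simp add: bracket_def A_scale scale_right_diff_distrib)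
  define H where "H m = A (1 + m) + A (1 - m)" for m
  define E where "E m = A (1 + m) - A (1 - m) + G m" for m
  define F where "F m = A (1 + m) - A (1 - m) - G m" for m
  note tri = Onsager_triangular[OF AA GA, folded H_def E_def F_def]
  have bracketD: "app a (app b v) = app b (app a v) + app c v" if "\<lblot>a, b\<rblot> = c" for a b c v
    using that by (auto simp: bracket_def)
  have app4: "app 4 v = scale 4 v" for v :: 'b using app_plus[of 2 2 v] by (simp add: app2 four)
  show ?thesis
  proof (rule that[of "\<lambda>m. app (H m)" "\<lambda>m. app (E m)" "\<lambda>m. app (F m)"])
    show "triangular_action scale Basis (\<lambda>m. app (H m)) (\<lambda>m. app (E m)) (\<lambda>m. app (F m))"
    proof (intro triangular_action.intro triangular_action_axioms.intro fin_dim_space_axioms)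
      show "app (H m) (app (H n) v) = app (H n) (app (H m) v)" for m n v
        using bracketD[OF tri(1)[of m n], of v] by simp
      show "app (H m) (app (E n) v) = app (E n) (app (H m) v) + scale 2 (app (E (n + m)) v + app (E (n - m)) v)" for m n v
        using bracketD[OF tri(2)[of m n], of v] by (simp add: app2 two)
      show "app (H m) (app (F n) v) = app (F n) (app (H m) v) - scale 2 (app (F (n + m)) v + app (F (n - m)) v)" for m n v
        using bracketD[OF tri(3)[of m n], of v] by (simp add: app2 two)
      show "app (E m) (app (F n) v) = app (F n) (app (E m) v) + scale 4 (app (H (m - n)) v - app (H (m + n)) v)" for m n v
        using bracketD[OF tri(4)[of m n], of v] by (simp add: app4 scale_right_diff_distrib)
      show "app (H (- m)) v = app (H m) v" for m v by (simp add: H_def)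
    qed (simp_all add: Vector_Spaces.linear_iff vector_space_axioms H_def E_def F_def A_scale G_scale
        scale_right_distrib scale_right_diff_distrib)
    show "app (H 0) v = scale 2 (Y v)" for v by (simp add: H_def A1 app two)
    \<comment> \<open>\<open>H 1 = A 2 + A 0\<close> and \<open>E 1 + F 1 = 2 (A 2 - A 0)\<close>,
      which leaves \<open>4 A 0\<close>.\<close>
    show "scale 4 (X v) = scale 2 (app (H 1) v) - (app (E 1) v + app (F 1) v)" for v
      by (simp add: H_def E_def F_def A0 app two four scale_right_distrib)
  qed
qed

section \<open>The graph of the self-duality\<close>

text \<open>The second component transforms by the transposed operators, which is why lowering \<open>u\<close> by
  \<open>F m\<close> goes with precomposing \<open>g\<close> with \<open>E m\<close>.\<close>

inductive dual_orbit :: "('a::field \<Rightarrow> 'b::ab_group_add \<Rightarrow> 'b) \<Rightarrow> (int \<Rightarrow> 'b \<Rightarrow> 'b) \<Rightarrow> (int \<Rightarrow> 'b \<Rightarrow> 'b)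
    \<Rightarrow> 'b \<Rightarrow> ('b \<Rightarrow> 'a) \<Rightarrow> 'b \<Rightarrow> ('b \<Rightarrow> 'a) \<Rightarrow> bool"
  for scale E F v f where
  base: "dual_orbit scale E F v f v f"
| add: "dual_orbit scale E F v f u g \<Longrightarrow> dual_orbit scale E F v f u' g'
    \<Longrightarrow> dual_orbit scale E F v f (u + u') (\<lambda>w. g w + g' w)"
| scale: "dual_orbit scale E F v f u g \<Longrightarrow> dual_orbit scale E F v f (scale c u) (\<lambda>w. c * g w)"
| lower: "dual_orbit scale E F v f u g \<Longrightarrow> dual_orbit scale E F v f (F m u) (\<lambda>w. g (E m w))"

text \<open>\<open>f\<close> is to the dual what \<open>v\<close> is to the space: raising on the
  dual is precomposition with \<open>F m\<close>, which annihilates \<open>f\<close>, and both have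
  weight \<open>\<mu>\<close>. The case \<open>f = 0\<close> is allowed and will be used.\<close>

locale highest_weight = triangular_action scale Basis H E F
  for scale :: "'a::field \<Rightarrow> 'b::ab_group_add \<Rightarrow> 'b" and Basis H E F +
  fixes v :: 'b and f :: "'b \<Rightarrow> 'a" and \<mu> :: "int \<Rightarrow> 'a"
  assumes f_add: "f (u + u') = f u + f u'" and f_scale: "f (scale c u) = c * f u"
    and H_v: "H m v = scale (\<mu> m) v" and f_H: "f (H m w) = \<mu> m * f w"
    and E_v: "E m v = 0" and f_F: "f (F m w) = 0"
begin

abbreviation "orbit \<equiv> dual_orbit scale E F v f"

lemmas ops = operator_0[OF linear_H] operator_add[OF linear_H] operator_diff[OF linear_H]
  operator_scale[OF linear_H] operator_0[OF linear_E] operator_add[OF linear_E]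
  operator_diff[OF linear_E] operator_scale[OF linear_E]
  operator_0[OF linear_F] operator_add[OF linear_F] operator_diff[OF linear_F]
  operator_scale[OF linear_F]

lemma orbit_linear:
  assumes "orbit u g"
  shows "g (w + w') = g w + g w'" and "g (scale c w) = c * g w"
proof -
  have "\<forall>w w' c. g (w + w') = g w + g w' \<and> g (scale c w) = c * g w"
    using assms by induction (simp_all add: f_add f_scale ops algebra_simps)
  then show "g (w + w') = g w + g w'" "g (scale c w) = c * g w" by blast+
qed

lemma orbit_diff_arg:
  assumes "orbit u g"
  shows "g (w - w') = g w - g w'"
  using orbit_linear(1)[OF assms, of "w - w'" w'] by simp

lemma orbit_diff:
  assumes "orbit u g" "orbit u' g'"
  shows "orbit (u - u') (\<lambda>w. g w - g' w)"
  using dual_orbit.add[OF assms(1) dual_orbit.scale[OF assms(2), of "-1"]] by simp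

text \<open>The orbit is generated by lowering alone. Moving \<open>H n\<close> past
  \<open>F m\<close> leaves further lowering terms, and moving it past \<open>E m\<close> under
  \<open>g\<close> produces the matching correction.\<close>

lemma orbit_H: "orbit u g \<Longrightarrow> orbit (H n u) (\<lambda>w. g (H n w))"
proof (induction rule: dual_orbit.induct)
  case base
  then show ?case using dual_orbit.scale[OF dual_orbit.base, of scale E F v f "\<mu> n"]
    by (simp add: H_v f_H)
next
  case (add u g u' g')
  then show ?case using dual_orbit.add by (fastforce simp: ops)
next
  case (scale u g c)
  then show ?case using dual_orbit.scale by (fastforce simp: ops)
next
  case (lower u g m)
  let ?c = "\<lambda>w. 2 * (g (E (m + n) w) + g (E (m - n) w))"
  have "orbit (F m (H n u)) (\<lambda>w. g (H n (E m w)))" by (rule dual_orbit.lower) fact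
  moreover have "orbit (scale 2 (F (m + n) u + F (m - n) u)) ?c"
    by (intro dual_orbit.scale dual_orbit.add dual_orbit.lower lower)
  ultimately have "orbit (F m (H n u) - scale 2 (F (m + n) u + F (m - n) u))
      (\<lambda>w. g (H n (E m w)) - ?c w)"
    by (rule orbit_diff)
  moreover have "g (E m (H n w)) = g (H n (E m w)) - ?c w" for w
    by (simp add: H_E orbit_linear[OF lower.hyps])
  ultimately show ?case by (simp add: H_F)
qed

text \<open>At the base pair both components become 0. Past a lowering step the correction consists
  of \<open>H\<close> terms, which \<open>orbit_H\<close> covers.\<close>

lemma orbit_E: "orbit u g \<Longrightarrow> orbit (E n u) (\<lambda>w. g (F n w))"
proof (induction rule: dual_orbit.induct)
  case base
  then show ?case using dual_orbit.scale[OF dual_orbit.base, of scale E F v f 0]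
    by (simp add: E_v f_F)
next
  case (add u g u' g')
  then show ?case using dual_orbit.add by (fastforce simp: ops)
next
  case (scale u g c)
  then show ?case using dual_orbit.scale by (fastforce simp: ops)
next
  case (lower u g m)
  let ?c = "\<lambda>w. 4 * (g (H (n - m) w) - g (H (n + m) w))"
  have "orbit (F m (E n u)) (\<lambda>w. g (F n (E m w)))" by (rule dual_orbit.lower) fact
  moreover have "orbit (scale 4 (H (n - m) u - H (n + m) u)) ?c"
    by (intro dual_orbit.scale orbit_diff orbit_H lower)
  ultimately have "orbit (F m (E n u) + scale 4 (H (n - m) u - H (n + m) u))
      (\<lambda>w. g (F n (E m w)) + ?c w)"
    by (rule dual_orbit.add)
  moreover have "g (E m (F n w)) = g (F n (E m w)) + ?c w" for w
    using H_uminus[of "m - n" w]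
    by (simp add: E_F orbit_linear[OF lower.hyps] orbit_diff_arg[OF lower.hyps] add.commute)
  ultimately show ?case by (simp add: E_F)
qed

text \<open>A lowering step makes both sides vanish, the left by \<open>f_F\<close> and the right by
  \<open>E_v\<close>. The identity controls the pairs with a zero component.\<close>

lemma orbit_symmetric: "orbit u g \<Longrightarrow> f u = g v"
proof (induction rule: dual_orbit.induct)
  case (lower u g m)
  then show ?case using orbit_linear(2)[OF lower.hyps, of 0] by (simp add: E_v f_F)
qed (simp_all add: f_add f_scale)

end

section \<open>Construction of the isomorphism onto the dual space\<close>

context krawtchouk_pair
begin

text \<open>The orbit of \<open>(v, f)\<close> is an invariant subspace of the product. Its first
  components, its pairs \<open>(u, 0)\<close> and the common zeros of all \<open>g\<close> paired
  with 0 each give an invariant subspace of an irreducible space; this makes the orbit the graph of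
  an injective map.\<close>

theorem dual_isomorphism:
  "\<exists>\<gamma>. td_iso scale UNIV X Y dual_scale (dual_space scale) (dual_map X) (dual_map Y) \<gamma>"
proof -
  obtain H E F where tri: "triangular_action scale Basis H E F"
    and H0: "\<And>v. H 0 v = scale 2 (Y v)"
    and X: "\<And>v. scale 4 (X v) = scale 2 (H 1 v) - (E 1 v + F 1 v)"
    using triangular_action_exists by blast
  interpret tri: triangular_action scale Basis H E F by fact
  obtain P where P: "Vector_Spaces.linear scale scale P"
    and P1: "\<And>v. Y v = scale (of_nat d) v \<Longrightarrow> P v = v"
    and P0: "\<And>v r. Y v = scale r v \<Longrightarrow> r \<noteq> of_nat d \<Longrightarrow> P v = 0"
    using flip.top_projection by blast
  have Yc: "Y v = scale (1 / 2) (H 0 v)" for v by (simp add: H0)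
  \<comment> \<open>At index 0 the two terms of \<open>H_E\<close> coincide and
    \<open>H 0 = 2 Y\<close>, so \<open>E m\<close> raises the eigenvalue of \<open>Y\<close> by 2;
    likewise \<open>F m\<close> lowers it by 2.\<close>
  have YE: "Y (E m v) = scale (r + 2) (E m v)" if "Y v = scale r v" for m v r
  proof -
    have "scale 2 (Y (E m v)) = scale 2 (E m (Y v) + scale 2 (E m v))"
      using tri.H_E[of 0 m v] scale_left_distrib[of 1 1 "E m v"]
      by (simp add: H0 operator_scale[OF tri.linear_E] scale_right_distrib)
    then have "Y (E m v) = E m (Y v) + scale 2 (E m v)"
      by (simp only: scale_cancel_left) simp
    then show ?thesis by (simp add: that operator_scale[OF tri.linear_E] scale_left_distrib)
  qed
  have YF: "Y (F m v) = scale (r - 2) (F m v)" if "Y v = scale r v" for m v r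
  proof -
    have "scale 2 (Y (F m v)) = scale 2 (F m (Y v) - scale 2 (F m v))"
      using tri.H_F[of 0 m v] scale_left_distrib[of 1 1 "F m v"]
      by (simp add: H0 operator_scale[OF tri.linear_F] scale_right_diff_distrib scale_right_distrib)
    then have "Y (F m v) = F m (Y v) - scale 2 (F m v)"
      by (simp only: scale_cancel_left) simp
    then show ?thesis by (simp add: that operator_scale[OF tri.linear_F] scale_left_diff_distrib)
  qed
  have YH: "Y (H m v) = H m (Y v)" for m v
    using tri.H_H[of 0 m v] by (simp add: H0 operator_scale[OF tri.linear_H])
  \<comment> \<open>\<open>d + 2\<close> lies outside the spectrum of \<open>Y\<close>, so lowering
    never reaches the top eigenspace (\<open>PF\<close>) and raising kills \<open>v\<close>
    (\<open>Ev\<close>).\<close>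
  have gap: "of_nat d + 2 \<noteq> (of_nat d - 2 * of_nat i :: 'a)" for i
  proof
    assume eq: "of_nat d + 2 = (of_nat d - 2 * of_nat i :: 'a)"
    have "2 * of_nat (Suc i) = of_nat d + 2 - (of_nat d - 2 * of_nat i :: 'a)" by simp
    then have "2 * of_nat (Suc i) = (0 :: 'a)" by (simp only: eq) simp
    then show False by (simp only: mult_eq_0_iff of_nat_eq_0_iff) simp
  qed
  have PF: "P (F m u) = 0" for m u
  proof (rule flip.operator_eqI[where f = "\<lambda>u. P (F m u)" and g = "\<lambda>u. 0"])
    fix u r assume u: "Y u = scale r u"
    show "P (F m u) = 0"
    proof (cases "u = 0")
      case False
      then obtain i where "r = of_nat d - 2 * of_nat i" using flip.spectrum u by blast
      then have "r - 2 \<noteq> of_nat d"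
        using gap[of i] by (auto simp: algebra_simps)
      then show ?thesis using P0 YF[OF u] by blast
    qed (simp add: operator_0[OF P] operator_0[OF tri.linear_F])
  qed (simp_all add: operator_add[OF P] operator_scale[OF P] operator_add[OF tri.linear_F]
      operator_scale[OF tri.linear_F])
  have PH: "P (H m u) = H m (P u)" for m u
  proof (rule flip.operator_eqI[where f = "\<lambda>u. P (H m u)"])
    fix u r assume u: "Y u = scale r u"
    then have "Y (H m u) = scale r (H m u)" by (simp add: YH operator_scale[OF tri.linear_H])
    then show "P (H m u) = H m (P u)"
      using P0[of "H m u" r] P0[of u r] P1[of "H m u"] P1[of u] u operator_0[OF tri.linear_H]
      by (cases "r = of_nat d") auto
  qed (simp_all add: operator_add[OF P] operator_scale[OF P] operator_add[OF tri.linear_H]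
      operator_scale[OF tri.linear_H])
  \<comment> \<open>The top eigenspace of \<open>Y\<close> is invariant under the commuting
    \<open>H m\<close>; a common eigenvector in it serves as highest weight vector.\<close>
  let ?U = "{u. Y u = scale (of_nat d) u}"
  have "subspace ?U"
    by (auto simp: subspace_def operator_0[OF linear_Y] operator_add[OF linear_Y]
        operator_scale[OF linear_Y] scale_right_distrib mult.commute)
  moreover have "H m ` ?U \<subseteq> ?U" for m
    by (auto simp: YH operator_scale[OF tri.linear_H])
  moreover have "?U \<noteq> {0}" using top_eigenvector by auto
  ultimately obtain v where v: "Y v = scale (of_nat d) v" "v \<noteq> 0" "\<forall>m. \<exists>r. H m v = scale r v"
    using common_eigenvector[of H ?U] tri.linear_H tri.H_H by blast
  then obtain \<mu> where \<mu>: "\<And>m. H m v = scale (\<mu> m) v" by metis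
  have Ev: "E m v = 0" for m
  proof (rule ccontr)
    assume "E m v \<noteq> 0"
    then obtain i where "of_nat d + 2 = (of_nat d - 2 * of_nat i :: 'a)"
      using flip.spectrum YE[OF v(1)] by blast
    then show False using gap by blast
  qed
  \<comment> \<open>Stated for a general functional, since it is applied both to 0 and to the
    \<open>f\<close> obtained from it.\<close>
  have weight: "highest_weight scale Basis H E F v f \<mu>"
    if "\<And>u u'. f (u + u') = f u + f u'" "\<And>c u. f (scale c u) = c * f u"
      "\<And>m w. f (H m w) = \<mu> m * f w" "\<And>m w. f (F m w) = 0" for f
    using that \<mu> Ev by (intro highest_weight.intro tri highest_weight_axioms.intro)
  have Xc: "X u = scale (1 / 4) (scale 2 (H 1 u) - (E 1 u + F 1 u))" for u
    using arg_cong[OF X, of "scale (1 / 4)"] by simp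
  have orbit_X: "dual_orbit scale E F v f (X u) (\<lambda>w. g (X w))"
    and orbit_Y: "dual_orbit scale E F v f (Y u) (\<lambda>w. g (Y w))"
    if f: "highest_weight scale Basis H E F v f \<mu>" and g: "dual_orbit scale E F v f u g" for f u g
  proof -
    interpret f: highest_weight scale Basis H E F v f \<mu> by fact
    have "f.orbit (scale (1 / 4) (scale 2 (H 1 u) - (E 1 u + F 1 u)))
        (\<lambda>w. 1 / 4 * (2 * g (H 1 w) - (g (F 1 w) + g (E 1 w))))"
      by (intro dual_orbit.scale f.orbit_diff dual_orbit.add f.orbit_H f.orbit_E dual_orbit.lower g)
    then show "f.orbit (X u) (\<lambda>w. g (X w))"
      by (simp add: Xc f.orbit_linear[OF g] f.orbit_diff_arg[OF g] add.commute)
    have "f.orbit (scale (1 / 2) (H 0 u)) (\<lambda>w. 1 / 2 * g (H 0 w))"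
      by (intro dual_orbit.scale f.orbit_H g)
    then show "f.orbit (Y u) (\<lambda>w. g (Y w))"
      by (simp only: Yc f.orbit_linear[OF g])
  qed
  have total: "\<exists>g. dual_orbit scale E F v f u g" if f: "highest_weight scale Basis H E F v f \<mu>" for f u
  proof -
    let ?W = "{u. \<exists>g. dual_orbit scale E F v f u g}"
    have "v \<in> ?W" using dual_orbit.base by fast
    moreover have "subspace ?W"
      unfolding subspace_def using dual_orbit.add dual_orbit.scale
        dual_orbit.scale[OF dual_orbit.base, of scale E F v f 0] by fastforce
    moreover have "X ` ?W \<subseteq> ?W" "Y ` ?W \<subseteq> ?W" using orbit_X[OF f] orbit_Y[OF f] by blast+
    ultimately have "?W = UNIV" using irreducible[of ?W] v(2) by blast
    then show ?thesis by blast
  qed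

  text \<open>Run with the zero functional, the orbit already shows that the top eigenspace of Y is a
    line, which is what makes the functional f below available.\<close>

  have "\<exists>c. P u = scale c v" for u
  proof -
    obtain g where "dual_orbit scale E F v (\<lambda>_. 0) u g" using total[OF weight[of "\<lambda>_. 0"]] by auto
    then show ?thesis
    proof (induction rule: dual_orbit.induct)
      case base
      then show ?case using P1[OF v(1)] by (metis scale_one)
    next
      case (add u g u' g')
      then show ?case by (metis operator_add[OF P] scale_left_distrib)
    next
      case (scale u g c)
      then show ?case by (metis operator_scale[OF P] scale_scale)
    next
      case (lower u g m)
      then show ?case by (metis PF scale_zero_left)
    qed
  qed
  \<comment> \<open>\<open>f\<close> is the coordinate along \<open>v\<close> of the projection to
    the top eigenspace.\<close>
  then obtain f where f: "\<And>u. P u = scale (f u) v" by metis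
  have f_eq: "f u = c" if "P u = scale c v" for u c
    using that f[of u] v(2) by simp
  have hw: "highest_weight scale Basis H E F v f \<mu>"
  proof (rule weight; rule f_eq)
    show "P (u + u') = scale (f u + f u') v" for u u'
      by (simp only: operator_add[OF P] f[of u] f[of u'] scale_left_distrib)
    show "P (scale c u) = scale (c * f u) v" for c u
      by (simp only: operator_scale[OF P] f[of u] scale_scale)
    show "P (H m w) = scale (\<mu> m * f w) v" for m w
      by (simp only: PH f[of w] operator_scale[OF tri.linear_H] \<mu> scale_scale mult.commute)
    show "P (F m w) = scale 0 v" for m w by (simp add: PF)
  qed
  interpret hw: highest_weight scale Basis H E F v f \<mu> by (fact hw)
  have fv: "f v = 1" by (rule f_eq) (simp add: P1[OF v(1)])
  \<comment> \<open>The vectors paired with 0 form an invariant subspace; it misses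
    \<open>v\<close>, since symmetry would give \<open>f v = 0\<close>.\<close>
  have left_unique: "u = 0" if "hw.orbit u (\<lambda>_. 0)" for u
  proof -
    let ?W = "{u. hw.orbit u (\<lambda>_. 0)}"
    have "subspace ?W"
      unfolding subspace_def
      using dual_orbit.add[of scale E F v f _ "\<lambda>_. 0" _ "\<lambda>_. 0"]
        dual_orbit.scale[of scale E F v f _ "\<lambda>_. 0"]
        dual_orbit.scale[OF dual_orbit.base, of scale E F v f 0] by auto
    moreover have "X ` ?W \<subseteq> ?W" "Y ` ?W \<subseteq> ?W"
      using orbit_X[OF hw, of _ "\<lambda>_. 0"] orbit_Y[OF hw, of _ "\<lambda>_. 0"] by auto
    moreover have "v \<notin> ?W" using hw.orbit_symmetric fv by force
    ultimately have "?W = {0}" using irreducible[of ?W] by blast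
    then show ?thesis using that by blast
  qed
  \<comment> \<open>The common zeros of the functionals paired with 0 form an invariant subspace; it
    contains \<open>v\<close>, since symmetry gives \<open>g v = f 0 = 0\<close>.\<close>
  have right_unique: "g w = 0" if "hw.orbit 0 g" for g w
  proof -
    let ?W = "{w. \<forall>g. hw.orbit 0 g \<longrightarrow> g w = 0}"
    have "subspace ?W"
      unfolding subspace_def
      by (auto simp: hw.orbit_linear) (metis hw.orbit_linear(2) mult_zero_left scale_zero_left)
    moreover have "X ` ?W \<subseteq> ?W" "Y ` ?W \<subseteq> ?W"
      using orbit_X[OF hw, of 0] orbit_Y[OF hw, of 0]
      by (auto simp: operator_0[OF linear_X] operator_0[OF linear_Y])
    moreover have "v \<in> ?W"
      using hw.orbit_symmetric[of 0] hw.f_scale[of 0 0] by simp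
    ultimately have "?W = UNIV" using irreducible[of ?W] v(2) by blast
    then show ?thesis using that by blast
  qed
  define \<gamma> where "\<gamma> u = (SOME g. hw.orbit u g)" for u
  have \<gamma>: "hw.orbit u (\<gamma> u)" for u
    unfolding \<gamma>_def using total[OF hw] by (rule someI_ex)
  have \<gamma>_eq: "\<gamma> u = g" if "hw.orbit u g" for u g
    using right_unique[of "\<lambda>w. \<gamma> u w - g w"] hw.orbit_diff[OF \<gamma>[of u] that] by (simp add: fun_eq_iff)
  have \<gamma>_add: "\<gamma> (u + u') = (\<lambda>w. \<gamma> u w + \<gamma> u' w)" for u u'
    by (intro \<gamma>_eq dual_orbit.add \<gamma>)
  have \<gamma>_scale: "\<gamma> (scale c u) = (\<lambda>w. c * \<gamma> u w)" for c u
    by (intro \<gamma>_eq dual_orbit.scale \<gamma>)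
  have \<gamma>_inj: "u = 0" if "\<gamma> u = (\<lambda>_. 0)" for u
    using \<gamma>[of u] left_unique that by simp
  have dual: "g \<in> dual_space scale \<longleftrightarrow> (\<forall>w w' c. g (w + w') = g w + g w' \<and> g (scale c w) = c * g w)" for g
  proof -
    have "vector_space ((*) :: 'a \<Rightarrow> 'a \<Rightarrow> 'a)" by unfold_locales (simp_all add: algebra_simps)
    then show ?thesis
      unfolding dual_space_def by (auto simp: Vector_Spaces.linear_iff vector_space_axioms)
  qed
  have onto: "\<exists>u. \<gamma> u = h" if h: "h \<in> dual_space scale" for h
  proof -
    \<comment> \<open>\<open>\<Psi> u\<close> has the values of \<open>\<gamma> u\<close> on
      \<open>Basis\<close> as coordinates. This replaces a dimension count for the dual by the fact
      that an injective endomorphism of a finite-dimensional space is surjective.\<close>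
    define \<Psi> where "\<Psi> u = (\<Sum>b\<in>Basis. scale (\<gamma> u b) b)" for u
    have coeff: "c b = c' b" if "(\<Sum>b\<in>Basis. scale (c b) b) = (\<Sum>b\<in>Basis. scale (c' b) b)" "b \<in> Basis"
      for c c' b
    proof -
      have "(\<Sum>b\<in>Basis. scale (c b - c' b) b) = 0"
        using that by (simp add: scale_left_diff_distrib sum_subtractf)
      from independentD[OF independent_Basis finite_Basis order_refl this that(2)] show ?thesis by simp
    qed
    have determined: "g = g'" if "g \<in> dual_space scale" "g' \<in> dual_space scale" "\<And>b. b \<in> Basis \<Longrightarrow> g b = g' b"
      for g g'
    proof
      fix w
      have "w \<in> span Basis" by (simp add: span_Basis)
      then show "g w = g' w"
      proof (induction rule: span_induct_alt)
        case base
        have "g (scale 0 0) = g' (scale 0 0)" using that(1,2) unfolding dual by (metis mult_zero_left)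
        then show ?case by simp
      next
        case (step c x y)
        then show ?case using that by (simp add: dual)
      qed
    qed
    have \<gamma>_dual: "\<gamma> u \<in> dual_space scale" for u
      using hw.orbit_linear[OF \<gamma>] by (simp add: dual)
    have lin: "Vector_Spaces.linear scale scale \<Psi>"
      by (simp add: Vector_Spaces.linear_iff vector_space_axioms \<Psi>_def \<gamma>_add \<gamma>_scale
          scale_left_distrib sum.distrib scale_sum_right)
    have "inj \<Psi>"
    proof (rule injI)
      fix u u' assume "\<Psi> u = \<Psi> u'"
      then have "\<gamma> u = \<gamma> u'" unfolding \<Psi>_def using coeff determined \<gamma>_dual by metis
      then have "\<gamma> (u + scale (- 1) u') = (\<lambda>_. 0)" by (simp only: \<gamma>_add \<gamma>_scale) simp
      from \<gamma>_inj[OF this] show "u = u'" by simp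
    qed
    then have "surj \<Psi>" using lin linear_inj_imp_surj by blast
    then obtain u where "(\<Sum>b\<in>Basis. scale (h b) b) = \<Psi> u" by (metis surjD)
    then have "\<gamma> u = h" unfolding \<Psi>_def using coeff determined \<gamma>_dual h by metis
    then show ?thesis by blast
  qed
  have "vector_space dual_scale"
    by unfold_locales (simp_all add: dual_scale_def fun_eq_iff algebra_simps)
  then have "Vector_Spaces.linear scale dual_scale \<gamma>"
    by (simp add: Vector_Spaces.linear_iff vector_space_axioms dual_scale_def \<gamma>_add \<gamma>_scale fun_eq_iff)
  moreover have "bij_betw \<gamma> UNIV (dual_space scale)"
  proof (rule bij_betw_imageI)
    show "inj \<gamma>"
    proof (rule injI)
      fix u u' assume "\<gamma> u = \<gamma> u'"
      then have "\<gamma> (u + scale (- 1) u') = (\<lambda>_. 0)" by (simp only: \<gamma>_add \<gamma>_scale) simp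
      from \<gamma>_inj[OF this] show "u = u'" by simp
    qed
    show "\<gamma> ` UNIV = dual_space scale"
    proof
      show "\<gamma> ` UNIV \<subseteq> dual_space scale" using hw.orbit_linear[OF \<gamma>] by (auto simp: dual)
      show "dual_space scale \<subseteq> \<gamma> ` UNIV" using onto by blast
    qed
  qed
  moreover have "\<gamma> (X u) = dual_map X (\<gamma> u)" "\<gamma> (Y u) = dual_map Y (\<gamma> u)" for u
    unfolding dual_map_def by (intro \<gamma>_eq orbit_X orbit_Y hw \<gamma>)+
  ultimately show ?thesis unfolding td_iso_def by blast
qed

end

section \<open>From standard orderings to the eigenvector formulation\<close>

lemma set_krawtchouk_seq:
  "set (krawtchouk_seq d) = (\<lambda>i. of_nat d - 2 * of_nat i :: 'a::field) ` {..d}"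
  by (auto simp: krawtchouk_seq_def atLeast0LessThan lessThan_Suc_atMost simp del: upt_Suc)

text \<open>Consecutive entries of \<open>krawtchouk_seq d\<close> differ by 2, so the adjacent
  eigenspaces are those for \<open>r + 2\<close> and \<open>r - 2\<close>; only the two ends need
  care.\<close>

lemma krawtchouk_tridiagonalI:
  fixes scale :: "'a::{alg_closed_field,field_char_0} \<Rightarrow> 'b::ab_group_add \<Rightarrow> 'b"
  assumes "alg_closed_fin_dim_space scale Basis"
    and A: "Vector_Spaces.linear scale scale A" and As: "Vector_Spaces.linear scale scale As"
    and diag: "diagonalizable_on scale UNIV A"
    and ord: "standard_ordering scale UNIV A As (krawtchouk_seq d)"
  shows "krawtchouk_tridiagonal scale Basis A As d"
proof -
  interpret alg_closed_fin_dim_space scale Basis by fact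
  have len: "length (krawtchouk_seq d :: 'a list) = Suc d" by (simp add: krawtchouk_seq_def)
  have nth: "krawtchouk_seq d ! i = (of_nat d - 2 * of_nat i :: 'a)" if "i \<le> d" for i
    using that by (simp add: krawtchouk_seq_def nth_append del: upt_Suc)
  have spec: "\<exists>i\<le>d. r = of_nat d - 2 * of_nat i" if "A v = scale r v" "v \<noteq> 0" for v r
  proof -
    have "r \<in> {\<theta>. is_eigenvalue scale UNIV A \<theta>}"
      using that by (auto simp: is_eigenvalue_def eigsp_def)
    then have "r \<in> set (krawtchouk_seq d)" using ord by (simp add: standard_ordering_def)
    then show ?thesis by (auto simp: set_krawtchouk_seq)
  qed
  have eigsp: "eigsp scale UNIV A r = {v. A v = scale r v}" for r by (simp add: eigsp_def)
  have eigsp_subspace: "subspace {v. A v = scale r v}" for r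
    by (auto simp: subspace_def operator_0[OF A] operator_add[OF A] operator_scale[OF A]
        scale_right_distrib mult.commute)
  have span_eigsp: "span {v. A v = scale r v} = {v. A v = scale r v}" for r
    using eigsp_subspace by (rule span_eq_iff[THEN iffD2])
  \<comment> \<open>Beyond the last index \<open>ord_eigsp\<close> is \<open>{0}\<close>, so there
    \<open>c = 0\<close> and the equation is trivial.\<close>
  have in_next: "A c = scale (r - 2) c"
    if "c \<in> span (ord_eigsp scale UNIV A (krawtchouk_seq d) (Suc i))" "r = of_nat d - 2 * of_nat i"
    for c r i
  proof (cases "Suc i \<le> d")
    case True
    have "of_nat d - 2 * of_nat (Suc i) = r - 2" using that(2) by simp
    then have "ord_eigsp scale UNIV A (krawtchouk_seq d) (Suc i) = {v. A v = scale (r - 2) v}"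
      using True by (simp only: ord_eigsp_def len nth eigsp) simp
    then show ?thesis using that(1) by (simp add: span_eigsp)
  next
    case False
    then show ?thesis using that by (simp add: ord_eigsp_def len operator_0[OF A])
  qed
  show ?thesis
  proof (intro krawtchouk_tridiagonal.intro krawtchouk_tridiagonal_axioms.intro)
    show "span {v. \<exists>r. A v = scale r v} = UNIV"
    proof -
      have "(\<Union>r. eigsp scale UNIV A r) = {v. \<exists>r. A v = scale r v}" by (auto simp: eigsp)
      then show ?thesis using diag by (simp add: diagonalizable_on_def)
    qed
    show "\<exists>a b c. As v = a + b + c \<and> A a = scale (r + 2) a \<and> A b = scale r b \<and> A c = scale (r - 2) c"
      if v: "A v = scale r v" for v r
    proof (cases "v = 0")
      case True
      then show ?thesis
        by (intro exI[of _ 0]) (simp add: operator_0[OF A] operator_0[OF As])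
    next
      case False
      then obtain i where i: "i \<le> d" "r = of_nat d - 2 * of_nat i" using spec v by blast
      let ?V = "ord_eigsp scale UNIV A (krawtchouk_seq d)"
      have Vi: "?V i = {v. A v = scale r v}" using i by (simp add: ord_eigsp_def len nth eigsp)
      have "As v \<in> span (?V (i - 1) \<union> ?V i \<union> ?V (Suc i))"
      proof -
        have "As ` ?V i \<subseteq> span (?V (i - 1) \<union> ?V i \<union> ?V (Suc i))"
          using ord i(1) len by (simp add: standard_ordering_def)
        then show ?thesis using v Vi by blast
      qed
      then obtain a b c where abc: "As v = a + b + c" "a \<in> span (?V (i - 1))" "b \<in> span (?V i)"
        "c \<in> span (?V (Suc i))"
        unfolding span_Un by auto
      have b: "A b = scale r b" using abc(3) Vi by (simp add: span_eigsp)
      have c: "A c = scale (r - 2) c" using in_next abc(4) i by blast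
      show ?thesis
      proof (cases i)
        \<comment> \<open>Here \<open>i - 1\<close> is 0 again, so \<open>a\<close> belongs to the
          eigenvalue \<open>r\<close>: it is merged with \<open>b\<close>, and the component for
          \<open>r + 2\<close> is 0.\<close>
        case 0
        then have "A (a + b) = scale r (a + b)"
          using abc(2) b Vi by (simp add: span_eigsp operator_add[OF A] scale_right_distrib)
        then show ?thesis using abc(1) c
          by (intro exI[of _ 0] exI[of _ "a + b"] exI[of _ c]) (simp add: operator_0[OF A])
      next
        case (Suc j)
        then have "of_nat d - 2 * of_nat j = r + 2" "j \<le> d" using i by simp_all
        then have "?V (i - 1) = {v. A v = scale (r + 2) v}"
          using Suc by (simp add: ord_eigsp_def len nth eigsp)
        then have "A a = scale (r + 2) a" using abc(2) by (simp add: span_eigsp)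
        then show ?thesis using abc(1) b c by blast
      qed
    qed
  qed (fact | use spec in blast)+
qed

theorem theorem11p1:
  fixes scale :: "'a::{alg_closed_field, field_char_0} \<Rightarrow> 'v::ab_group_add \<Rightarrow> 'v"
    and A As :: "'v \<Rightarrow> 'v"
  assumes "vector_space scale"
    and "\<exists>S. finite S \<and> module.span scale S = UNIV"
    and "(UNIV :: 'v set) \<noteq> {0}"
    and "td_pair scale UNIV A As"
    and "krawtchouk_type scale UNIV A As"
  shows "td_isomorphic scale UNIV A As dual_scale (dual_space scale) (dual_map A) (dual_map As)"
proof -
  interpret vector_space scale by fact
  obtain S where S: "finite S" "span S = UNIV" using assms(2) by blast
  obtain B where B: "B \<subseteq> S" "independent B" "S \<subseteq> span B"
    using maximal_independent_subset by blast
  have fin: "alg_closed_fin_dim_space scale B"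
  proof (intro alg_closed_fin_dim_space.intro fin_dim_space.intro
      finite_dimensional_vector_space.intro finite_dimensional_vector_space_axioms.intro assms(1))
    show "finite B" using B S finite_subset by blast
    show "span B = UNIV" using span_mono[OF B(3)] S by (simp add: span_span top.extremum_uniqueI)
  qed (fact B)
  obtain d where d: "standard_ordering scale UNIV A As (krawtchouk_seq d)"
    "standard_ordering scale UNIV As A (krawtchouk_seq d)"
    using assms(5) by (auto simp: krawtchouk_type_def)
  have "krawtchouk_tridiagonal scale B A As d" "krawtchouk_tridiagonal scale B As A d"
    using krawtchouk_tridiagonalI[OF fin] d assms(4) by (simp_all add: td_pair_def)
  moreover have "\<exists>v. v \<noteq> 0 \<and> As v = scale (of_nat d) v"
  proof -
    have "of_nat d \<in> set (krawtchouk_seq d :: 'a list)" by (force simp: set_krawtchouk_seq)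
    then have "eigsp scale UNIV As (of_nat d) \<noteq> {0}"
      using d(2) by (simp add: standard_ordering_def is_eigenvalue_def)
    \<comment> \<open>The inequality with \<open>{0}\<close> would also hold for the empty set;
      membership of 0 is what turns it into a nonzero eigenvector.\<close>
    moreover have "0 \<in> eigsp scale UNIV As (of_nat d)"
      using assms(4) by (simp add: eigsp_def td_pair_def Vector_Spaces.linear_iff) (metis add_cancel_right_right)
    ultimately show ?thesis by (auto simp: eigsp_def)
  qed
  ultimately have "krawtchouk_pair scale B A As d"
    using assms(4) by (intro krawtchouk_pair.intro krawtchouk_pair_axioms.intro) (auto simp: td_pair_def)
  from krawtchouk_pair.dual_isomorphism[OF this] show ?thesis
    by (simp add: td_isomorphic_def)
qed

end
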